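(* Let $V$ be a countable (finite or infinite) set with at least two elements. Let $(K_t)_{t\ge1}$ be a sequence of irreducible aperiodic Markov transition operators on $V$ and $(\pi_t)_{t\ge1}$ a sequence of positive measures such that $\{(K_t,\pi_t)\}_{t\ge1}$ is a finite non-decreasing environment. For each $t\ge1$ let $\gamma_t=\gamma(K_t^*K_t)$ be the Poincaré constant and $\alpha_t=\alpha(K_t^*K_t)$ the logarithmic Sobolev constant of $K_t^*K_t$, where $K_t^*$ is the adjoint of $K_t$ on $\ell^2(\tilde\pi_t)$. For $s\ge1$ and $z\in V$ define $$q_s=2\prod_{u=1}^s(1+\alpha_u),\qquad r_z=\min\left\{s\ge1\;\Big|\;\log(q_s)\ge\log\left(\log\left(\frac{1}{\tilde\pi_1(z)}\right)\right)\right\}.$$ For $x,y\in V$ let $r=r(x,y)=\max(r_x,r_y)$. Then $$\forall t\ge r(x,y),\quad d_{TV}(\mu_t^x,\mu_t^y)\le e\sqrt{\frac{\pi_t(V)}{\pi_1(V)}}\prod_{l=r+1}^t\sqrt{1-\gamma_l}.$$ Therefore, for all $\eta\in(0,1)$, $$T_{\mathrm{mer}}(x,y,\eta)\le r(x,y)+\min\left\{u\ge1\;\Big|\; e\sqrt{\frac{\pi_{r+u}(V)}{\pi_1(V)}}\prod_{l=r+1}^{r+u}\sqrt{1-\gamma_l}\le\eta\right\},$$ with the convention $\min\emptyset=+\infty$ (if $r(x,y)=+\infty$ the assertions are void).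
   Context: A Markov transition operator $K$ on $V$ is a map $K:V\times V\to[0,1]$ with $\sum_y K(x,y)=1$ for all $x$; it acts on functions by $(Kf)(x)=\sum_y K(x,y)f(y)$ and on measures by $(\mu K)(y)=\sum_x\mu(x)K(x,y)$. Finite non-decreasing environment: the $\pi_t$ are positive measures ($\pi_t(x)>0$ for all $x$) with, for all $t\ge1$: $\pi_tK_t=\pi_t$; $\pi_t(V)<+\infty$; $\pi_{t+1}(x)\ge\pi_t(x)$ for all $x\in V$. For a finite measure $\pi$, $\tilde\pi:=\pi/\pi(V)$. Laws: $\mu_t^x=\delta_xK_1K_2\cdots K_t$. $d_{TV}(\mu,\nu)=\frac12\sum_x|\mu(x)-\nu(x)|$; $T_{\mathrm{mer}}(x,y,\eta)=\inf\{t\ge1\mid d_{TV}(\mu_t^x,\mu_t^y)\le\eta\}$. For $Q=K^*K$ with $K$ having invariant probability $\tilde\pi$: $\mathcal E_{Q,\tilde\pi}(f,f)=\langle(I-Q)f,f\rangle_{\tilde\pi}=\frac12\sum_{x,y}(f(x)-f(y))^2\tilde\pi(x)Q(x,y)$, $\operatorname{Var}_{\tilde\pi}(f)=\tilde\pi(f^2)-\tilde\pi(f)^2$. The Poincaré constant $\gamma(Q)\ge0$ is the largest $\gamma$ with $\gamma\operatorname{Var}_{\tilde\pi}(f)\le\mathcal E_{Q,\tilde\pi}(f,f)$ for all $f\in\ell^2(\tilde\pi)$. The entropy of a non-negative $f\in\ell^1(\tilde\pi)$ is $\mathcal L(f\mid\tilde\pi)=\sum_xf(x)\log\left(\frac{f(x)}{\tilde\pi(f)}\right)\tilde\pi(x)\in[0,+\infty]$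 (with $0\log 0=0$, and $\mathcal L(0\mid\tilde\pi)=0$). The logarithmic Sobolev constant $\alpha(Q)\ge0$ is the largest $\alpha\ge 0$ with $\alpha\,\mathcal L(f^2\mid\tilde\pi)\le\mathcal E_{Q,\tilde\pi}(f,f)$ for all non-constant non-negative $f\in\ell^2(\tilde\pi)$ (with $0\cdot\infty=0$). *)

theory Defs
  imports "HOL-Analysis.Analysis" "HOL-Library.Extended_Nat"
begin

text \<open>The state space is a countable type; kernels are functions of two arguments, and measures
  are identified with their point masses.\<close>

definition kernel_act :: "('a \<Rightarrow> 'a \<Rightarrow> real) \<Rightarrow> ('a \<Rightarrow> real) \<Rightarrow> 'a \<Rightarrow> real" where
  "kernel_act K f x = (\<Sum>\<^sub>\<infinity>y. K x y * f y)"

definition measure_act :: "('a \<Rightarrow> real) \<Rightarrow> ('a \<Rightarrow> 'a \<Rightarrow> real) \<Rightarrow> 'a \<Rightarrow> real" where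
  "measure_act \<mu> K y = (\<Sum>\<^sub>\<infinity>x. \<mu> x * K x y)"

definition kernel_comp :: "('a \<Rightarrow> 'a \<Rightarrow> real) \<Rightarrow> ('a \<Rightarrow> 'a \<Rightarrow> real) \<Rightarrow> 'a \<Rightarrow> 'a \<Rightarrow> real" where
  "kernel_comp K L x y = (\<Sum>\<^sub>\<infinity>z. K x z * L z y)"

primrec kernel_power :: "('a \<Rightarrow> 'a \<Rightarrow> real) \<Rightarrow> nat \<Rightarrow> 'a \<Rightarrow> 'a \<Rightarrow> real" where
  "kernel_power K 0 = (\<lambda>x y. if x = y then 1 else 0)"
| "kernel_power K (Suc n) = kernel_comp (kernel_power K n) K"

definition markov_kernel :: "('a \<Rightarrow> 'a \<Rightarrow> real) \<Rightarrow> bool" where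
  "markov_kernel K \<longleftrightarrow>
     (\<forall>x y. 0 \<le> K x y \<and> K x y \<le> 1) \<and> (\<forall>x. (K x has_sum 1) UNIV)"

definition irreducible_kernel :: "('a \<Rightarrow> 'a \<Rightarrow> real) \<Rightarrow> bool" where
  "irreducible_kernel K \<longleftrightarrow> (\<forall>x y. \<exists>n\<ge>1. kernel_power K n x y > 0)"

definition aperiodic_kernel :: "('a \<Rightarrow> 'a \<Rightarrow> real) \<Rightarrow> bool" where
  "aperiodic_kernel K \<longleftrightarrow> (\<forall>x. Gcd {n. n \<ge> 1 \<and> kernel_power K n x x > 0} = 1)"

definition total_mass :: "('a \<Rightarrow> real) \<Rightarrow> real" where
  "total_mass \<pi> = (\<Sum>\<^sub>\<infinity>x. \<pi> x)"

definition normalized :: "('a \<Rightarrow> real) \<Rightarrow> 'a \<Rightarrow> real" where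
  "normalized \<pi> x = \<pi> x / total_mass \<pi>"

definition finite_nondecreasing_env ::
    "(nat \<Rightarrow> 'a \<Rightarrow> 'a \<Rightarrow> real) \<Rightarrow> (nat \<Rightarrow> 'a \<Rightarrow> real) \<Rightarrow> bool" where
  "finite_nondecreasing_env K \<pi> \<longleftrightarrow>
     (\<forall>t\<ge>1. (\<forall>x. \<pi> t x > 0) \<and> measure_act (\<pi> t) (K t) = \<pi> t \<and>
            \<pi> t summable_on UNIV \<and> (\<forall>x. \<pi> (t + 1) x \<ge> \<pi> t x))"

primrec law :: "(nat \<Rightarrow> 'a \<Rightarrow> 'a \<Rightarrow> real) \<Rightarrow> 'a \<Rightarrow> nat \<Rightarrow> 'a \<Rightarrow> real" where
  "law K x 0 = (\<lambda>y. if y = x then 1 else 0)"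
| "law K x (Suc t) = measure_act (law K x t) (K (Suc t))"

definition d_TV :: "('a \<Rightarrow> real) \<Rightarrow> ('a \<Rightarrow> real) \<Rightarrow> real" where
  "d_TV \<mu> \<nu> = (1/2) * (\<Sum>\<^sub>\<infinity>x. \<bar>\<mu> x - \<nu> x\<bar>)"

text \<open>In \<^typ>\<open>enat\<close> the infimum of the empty set is \<open>\<infinity>\<close>.\<close>

definition T_mer :: "(nat \<Rightarrow> 'a \<Rightarrow> 'a \<Rightarrow> real) \<Rightarrow> 'a \<Rightarrow> 'a \<Rightarrow> real \<Rightarrow> enat" where
  "T_mer K x y \<eta> = Inf (enat ` {t. t \<ge> 1 \<and> d_TV (law K x t) (law K y t) \<le> \<eta>})"

definition mean :: "('a \<Rightarrow> real) \<Rightarrow> ('a \<Rightarrow> real) \<Rightarrow> real" where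
  "mean p f = (\<Sum>\<^sub>\<infinity>x. f x * p x)"

definition l2_space :: "('a \<Rightarrow> real) \<Rightarrow> ('a \<Rightarrow> real) set" where
  "l2_space p = {f. (\<lambda>x. (f x)\<^sup>2 * p x) summable_on UNIV}"

definition l2_inner :: "('a \<Rightarrow> real) \<Rightarrow> ('a \<Rightarrow> real) \<Rightarrow> ('a \<Rightarrow> real) \<Rightarrow> real" where
  "l2_inner p f g = (\<Sum>\<^sub>\<infinity>x. f x * g x * p x)"

definition l2_adjoint :: "('a \<Rightarrow> real) \<Rightarrow> ('a \<Rightarrow> 'a \<Rightarrow> real) \<Rightarrow> 'a \<Rightarrow> 'a \<Rightarrow> real" where
  "l2_adjoint p K = (THE Ks. \<forall>f\<in>l2_space p. \<forall>g\<in>l2_space p.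
     l2_inner p (kernel_act K f) g = l2_inner p f (kernel_act Ks g))"

definition variance :: "('a \<Rightarrow> real) \<Rightarrow> ('a \<Rightarrow> real) \<Rightarrow> real" where
  "variance p f = mean p (\<lambda>x. (f x)\<^sup>2) - (mean p f)\<^sup>2"

definition dirichlet_form :: "('a \<Rightarrow> 'a \<Rightarrow> real) \<Rightarrow> ('a \<Rightarrow> real) \<Rightarrow> ('a \<Rightarrow> real) \<Rightarrow> real" where
  "dirichlet_form Q p f = l2_inner p (\<lambda>x. f x - kernel_act Q f x) f"

text \<open>The sum is taken in \<^typ>\<open>ereal\<close>: the negative parts are summable since
  \<open>u ln (u / m) \<ge> - m / e\<close>, so it always converges unconditionally, possibly to \<open>\<infinity>\<close>.
  The conventions \<open>ln 0 = 0\<close> and \<open>u / 0 = 0\<close> give \<open>0 log 0 = 0\<close> and entropy \<open>0\<close> for \<open>f = 0\<close>.\<close>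

definition entropy :: "('a \<Rightarrow> real) \<Rightarrow> ('a \<Rightarrow> real) \<Rightarrow> ereal" where
  "entropy p f = (\<Sum>\<^sub>\<infinity>x. ereal (f x * ln (f x / mean p f) * p x))"

definition poincare_const :: "('a \<Rightarrow> 'a \<Rightarrow> real) \<Rightarrow> ('a \<Rightarrow> real) \<Rightarrow> real" where
  "poincare_const Q p =
     (GREATEST \<gamma>. \<forall>f\<in>l2_space p. \<gamma> * variance p f \<le> dirichlet_form Q p f)"

text \<open>In \<^typ>\<open>ereal\<close>, \<open>0 * \<infinity> = 0\<close>.\<close>

definition log_sobolev_const :: "('a \<Rightarrow> 'a \<Rightarrow> real) \<Rightarrow> ('a \<Rightarrow> real) \<Rightarrow> real" where
  "log_sobolev_const Q p =
     (GREATEST \<alpha>. 0 \<le> \<alpha> \<and>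
        (\<forall>f\<in>l2_space p. (\<forall>x. 0 \<le> f x) \<and> \<not> f constant_on UNIV \<longrightarrow>
           ereal \<alpha> * entropy p (\<lambda>x. (f x)\<^sup>2) \<le> ereal (dirichlet_form Q p f)))"

definition mult_sym :: "('a \<Rightarrow> 'a \<Rightarrow> real) \<Rightarrow> ('a \<Rightarrow> real) \<Rightarrow> 'a \<Rightarrow> 'a \<Rightarrow> real" where
  "mult_sym K p = kernel_comp (l2_adjoint p K) K"

definition gamma_env ::
    "(nat \<Rightarrow> 'a \<Rightarrow> 'a \<Rightarrow> real) \<Rightarrow> (nat \<Rightarrow> 'a \<Rightarrow> real) \<Rightarrow> nat \<Rightarrow> real" where
  "gamma_env K \<pi> t = poincare_const (mult_sym (K t) (normalized (\<pi> t))) (normalized (\<pi> t))"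

definition alpha_env ::
    "(nat \<Rightarrow> 'a \<Rightarrow> 'a \<Rightarrow> real) \<Rightarrow> (nat \<Rightarrow> 'a \<Rightarrow> real) \<Rightarrow> nat \<Rightarrow> real" where
  "alpha_env K \<pi> t = log_sobolev_const (mult_sym (K t) (normalized (\<pi> t))) (normalized (\<pi> t))"

definition q_env ::
    "(nat \<Rightarrow> 'a \<Rightarrow> 'a \<Rightarrow> real) \<Rightarrow> (nat \<Rightarrow> 'a \<Rightarrow> real) \<Rightarrow> nat \<Rightarrow> real" where
  "q_env K \<pi> s = 2 * (\<Prod>u=1..s. 1 + alpha_env K \<pi> u)"

definition r_env ::
    "(nat \<Rightarrow> 'a \<Rightarrow> 'a \<Rightarrow> real) \<Rightarrow> (nat \<Rightarrow> 'a \<Rightarrow> real) \<Rightarrow> 'a \<Rightarrow> enat" where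
  "r_env K \<pi> z =
     Inf (enat ` {s. s \<ge> 1 \<and> ln (q_env K \<pi> s) \<ge> ln (ln (1 / normalized (\<pi> 1) z))})"

lemma l2_adjoint_eq:
  fixes K :: "'a \<Rightarrow> 'a \<Rightarrow> real"
  assumes K: "markov_kernel K" and pos: "\<And>x. p x > 0" and "p summable_on UNIV"
    and inv: "measure_act p K = p"
  shows "l2_adjoint p K = (\<lambda>x y. p y * K y x / p x)" (is "_ = ?Ks")
    and "\<lbrakk>f \<in> l2_space p; g \<in> l2_space p\<rbrakk> \<Longrightarrow>
           l2_inner p (kernel_act K f) g = l2_inner p f (kernel_act (l2_adjoint p K) g)"
proof -
  have K0: "K x y \<ge> 0" and Ksum: "(K x has_sum 1) UNIV" for x y
    using K by (auto simp: markov_kernel_def)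
  have invsum: "((\<lambda>x. p x * K x y) has_sum p y) UNIV" for y
  proof -
    have "(\<Sum>\<^sub>\<infinity>x. p x * K x y) = p y"
      using fun_cong[OF inv, of y] by (simp add: measure_act_def)
    moreover from this have "(\<lambda>x. p x * K x y) summable_on UNIV"
      using pos[of y] infsum_not_exists by (metis less_irrefl)
    ultimately show ?thesis by (metis has_sum_infsum)
  qed
  have adj: "l2_inner p (kernel_act K f) g = l2_inner p f (kernel_act ?Ks g)"
    if f: "f \<in> l2_space p" and g: "g \<in> l2_space p" for f g
  proof -
    let ?F = "\<lambda>x y. p x * K x y * f y * g x"
    have s1: "(\<lambda>(x, y). p x * K x y * (g x)\<^sup>2) summable_on UNIV \<times> UNIV"
    proof (rule summable_on_SigmaI)
      show "((\<lambda>y. case (x, y) of (x, y) \<Rightarrow> p x * K x y * (g x)\<^sup>2) has_sum (g x)\<^sup>2 * p x) UNIV" for x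
        using has_sum_cmult_right[OF Ksum[of x], of "(g x)\<^sup>2 * p x"] by (simp add: algebra_simps)
      show "(\<lambda>x. (g x)\<^sup>2 * p x) summable_on UNIV" using g by (simp add: l2_space_def)
    qed (use K0 less_imp_le[OF pos] in auto)
    have "(\<lambda>(y, x). p x * K x y * (f y)\<^sup>2) summable_on UNIV \<times> UNIV"
    proof (rule summable_on_SigmaI)
      show "((\<lambda>x. case (y, x) of (y, x) \<Rightarrow> p x * K x y * (f y)\<^sup>2) has_sum (f y)\<^sup>2 * p y) UNIV" for y
        using has_sum_cmult_right[OF invsum[of y], of "(f y)\<^sup>2"] by (simp add: algebra_simps)
      show "(\<lambda>x. (f x)\<^sup>2 * p x) summable_on UNIV" using f by (simp add: l2_space_def)
    qed (use K0 less_imp_le[OF pos] in auto)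
    then have s2: "(\<lambda>(x, y). p x * K x y * (f y)\<^sup>2) summable_on UNIV \<times> UNIV"
      by (subst (asm) product_swap[symmetric], subst (asm) summable_on_reindex)
         (auto simp: o_def case_prod_unfold prod.swap_def)
    have "(\<lambda>(x, y). ?F x y) summable_on UNIV \<times> UNIV"
    proof (rule abs_summable_summable, rule Infinite_Sum.abs_summable_on_comparison_test')
      show "(\<lambda>z. (case z of (x, y) \<Rightarrow> p x * K x y * (g x)\<^sup>2) +
              (case z of (x, y) \<Rightarrow> p x * K x y * (f y)\<^sup>2)) summable_on UNIV \<times> UNIV"
        by (rule summable_on_add[OF s1 s2])
      fix z :: "'a \<times> 'a"
      obtain x y where z: "z = (x, y)" by fastforce
      have *: "\<bar>f y * g x\<bar> \<le> (g x)\<^sup>2 + (f y)\<^sup>2"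
      proof -
        have "0 \<le> (\<bar>f y\<bar> - \<bar>g x\<bar>)\<^sup>2" by simp
        then have "2 * \<bar>f y * g x\<bar> \<le> (g x)\<^sup>2 + (f y)\<^sup>2"
          by (simp add: power2_diff abs_mult algebra_simps)
        then show ?thesis by (smt (verit) abs_ge_zero)
      qed
      have "norm (?F x y) = p x * K x y * \<bar>f y * g x\<bar>"
        using pos[of x] K0[of x y] by (simp add: abs_mult)
      also have "\<dots> \<le> p x * K x y * ((g x)\<^sup>2 + (f y)\<^sup>2)"
        using pos[of x] K0[of x y] * by (intro mult_left_mono) auto
      finally show "norm (case z of (x, y) \<Rightarrow> ?F x y) \<le>
          (case z of (x, y) \<Rightarrow> p x * K x y * (g x)\<^sup>2) + (case z of (x, y) \<Rightarrow> p x * K x y * (f y)\<^sup>2)"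
        by (simp add: z algebra_simps)
    qed
    then have swap: "(\<Sum>\<^sub>\<infinity>x. \<Sum>\<^sub>\<infinity>y. ?F x y) = (\<Sum>\<^sub>\<infinity>y. \<Sum>\<^sub>\<infinity>x. ?F x y)"
      by (rule infsum_swap_banach)
    have "l2_inner p (kernel_act K f) g = (\<Sum>\<^sub>\<infinity>x. (g x * p x) * (\<Sum>\<^sub>\<infinity>y. K x y * f y))"
      by (simp add: l2_inner_def kernel_act_def mult_ac)
    also have "\<dots> = (\<Sum>\<^sub>\<infinity>x. \<Sum>\<^sub>\<infinity>y. ?F x y)"
      by (subst infsum_cmult_right'[symmetric]) (simp add: mult_ac)
    also have "\<dots> = (\<Sum>\<^sub>\<infinity>y. \<Sum>\<^sub>\<infinity>x. (f y * p y) * (p x * K x y / p y * g x))"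
      unfolding swap using pos by (intro infsum_cong) (simp add: less_imp_neq[symmetric])
    also have "\<dots> = (\<Sum>\<^sub>\<infinity>y. (f y * p y) * (\<Sum>\<^sub>\<infinity>x. p x * K x y / p y * g x))"
      by (subst infsum_cmult_right') simp
    also have "\<dots> = l2_inner p f (kernel_act ?Ks g)"
      by (simp add: l2_inner_def kernel_act_def mult_ac)
    finally show ?thesis .
  qed
  have single: "(\<Sum>\<^sub>\<infinity>x. if x = a then h x else 0) = h a" for a :: 'a and h :: "'a \<Rightarrow> real"
    using infsum_cong_neutral[of "{a}" UNIV h "\<lambda>x. if x = a then h x else 0"] by simp
  have uniq: "L = M"
    if eq: "\<forall>f\<in>l2_space p. \<forall>g\<in>l2_space p.
              l2_inner p f (kernel_act L g) = l2_inner p f (kernel_act M g)" for L M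
  proof (intro ext)
    fix x y
    define d :: "'a \<Rightarrow> 'a \<Rightarrow> real" where "d a = (\<lambda>b. if b = a then 1 else 0)" for a
    have d: "d a \<in> l2_space p" for a
    proof -
      have "(\<lambda>b. (d a b)\<^sup>2 * p b) summable_on UNIV \<longleftrightarrow> (\<lambda>b. (d a b)\<^sup>2 * p b) summable_on {a}"
        by (rule summable_on_cong_neutral) (auto simp: d_def)
      then show ?thesis by (simp add: l2_space_def)
    qed
    have val: "l2_inner p (d x) (kernel_act N (d y)) = N x y * p x" for N
      using single[of x "\<lambda>b. kernel_act N (d y) b * p b"] single[of y "N x"]
      by (simp add: l2_inner_def kernel_act_def d_def if_distrib if_distribR cong: if_cong)
    show "L x y = M x y"
      using eq d val[of L] val[of M] pos[of x] by (metis less_irrefl mult_right_cancel)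
  qed
  show eq: "l2_adjoint p K = ?Ks"
    unfolding l2_adjoint_def by (rule the_equality) (use adj in \<open>auto intro!: uniq\<close>)
  show "l2_inner p (kernel_act K f) g = l2_inner p f (kernel_act (l2_adjoint p K) g)"
    if "f \<in> l2_space p" "g \<in> l2_space p" using adj[OF that] eq by simp
qed

end

theory Submission
  imports Defs
begin

text \<open>
  Test the difference of the two laws against a function \<open>f\<close> with \<open>\<bar>f\<bar> \<le> 1\<close>, and let
  \<open>g = K\<^sub>r\<^sub>+\<^sub>1 \<dots> K\<^sub>t f\<close>. The Poincare inequality contracts the unnormalized variance
  \<open>\<pi>\<^sub>l(V) Var\<^sub>l = min\<^sub>c \<pi>\<^sub>l((\<cdot> - c)\<^sup>2)\<close> by \<open>1 - \<gamma>\<^sub>l\<close> at each step, and passing from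
  \<open>\<pi>\<^sub>l\<close> to \<open>\<pi>\<^sub>l\<^sub>-\<^sub>1 \<le> \<pi>\<^sub>l\<close> only decreases it. So \<open>g\<close> is close in \<open>L\<^sup>2(\<pi>\<^sub>r)\<close> to a constant \<open>c\<close>.
  The logarithmic Sobolev inequality makes each \<open>K\<^sub>u\<close> a contraction from \<open>L\<^sup>q\<close> to
  \<open>L\<^sup>q\<^sup>(\<^sup>1\<^sup>+\<^sup>\<alpha>\<^sup>)\<close>, so \<open>K\<^sub>1 \<dots> K\<^sub>r (g - c)\<close> is controlled in
  \<open>L\<^sup>q(\<pi>\<^sub>1)\<close> with \<open>q = q\<^sub>r\<close>. A point evaluation at \<open>x\<close> costs the factor
  \<open>(1 / p x) powr (1 / q\<^sub>r)\<close> with \<open>p\<close> the normalized \<open>\<pi>\<^sub>1\<close>, and \<open>r\<close> is chosen so that this is at most \<open>e\<close>.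
\<close>

section \<open>Summation and convexity tools\<close>

lemma summable_on_dominated:
  fixes f g :: "'a \<Rightarrow> real"
  assumes "g summable_on A" and "\<And>x. x \<in> A \<Longrightarrow> \<bar>f x\<bar> \<le> g x"
  shows "f summable_on A"
  by (rule abs_summable_summable, rule Infinite_Sum.abs_summable_on_comparison_test'[OF assms(1)])
     (use assms(2) in auto)

text \<open>A nonnegative majorant with summable column sums is summable on the product, so the
  order of summation is free. Column sums are the natural data here: those of
  \<open>p x * K x y\<close> are given by invariance of \<open>p\<close>.\<close>

lemma fubini_dominated:
  fixes F w :: "'a \<Rightarrow> 'b \<Rightarrow> real"
  assumes le: "\<And>x y. \<bar>F x y\<bar> \<le> w x y"
    and w: "\<And>y. ((\<lambda>x. w x y) has_sum c y) UNIV"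
    and c: "c summable_on UNIV"
  shows "F x summable_on UNIV"
    and "((\<lambda>x. \<Sum>\<^sub>\<infinity>y. F x y) has_sum (\<Sum>\<^sub>\<infinity>y. \<Sum>\<^sub>\<infinity>x. F x y)) UNIV"
proof -
  have w0: "0 \<le> w x y" for x y using le[of x y] by linarith
  have "(\<lambda>(y, x). w x y) summable_on UNIV \<times> UNIV"
    by (rule summable_on_SigmaI[where g = c]) (use w c w0 in auto)
  then have "(\<lambda>(x, y). w x y) summable_on UNIV \<times> UNIV"
    by (subst summable_on_swap) simp
  then have s: "(\<lambda>(x, y). F x y) summable_on UNIV \<times> UNIV"
    by (rule summable_on_dominated) (use le in auto)
  from summable_on_SigmaD1[OF this] show row: "F x summable_on UNIV" for x by simp
  have "(\<lambda>x. \<Sum>\<^sub>\<infinity>y. F x y) summable_on UNIV"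
    using summable_on_Sigma_banach[of F] s by simp
  then show "((\<lambda>x. \<Sum>\<^sub>\<infinity>y. F x y) has_sum (\<Sum>\<^sub>\<infinity>y. \<Sum>\<^sub>\<infinity>x. F x y)) UNIV"
    using infsum_swap_banach[OF s] by (simp add: has_sum_iff)
qed

text \<open>Convexity of the power on the half-line: its graph lies above the tangent at
  \<open>m\<close>. This is the supporting line for the Jensen inequality with powers.\<close>

lemma powr_tangent:
  fixes a m s :: real
  assumes "0 \<le> a" "0 \<le> m" "1 \<le> s"
  shows "m powr s + s * m powr (s - 1) * (a - m) \<le> a powr s"
proof (cases "m = 0")
  case False
  then have m: "0 < m" using assms by simp
  have ms: "m powr s = m powr (s - 1) * m" using m by (simp add: powr_diff)
  show ?thesis
  proof (cases "a = 0")
    case True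
    have "m powr s * 1 \<le> m powr s * s" using assms by (intro mult_left_mono) auto
    then show ?thesis using True ms by (simp add: algebra_simps)
  next
    case False
    then have a: "0 < a" using assms by simp
    \<comment> \<open>Young's inequality with weights \<open>1 / s\<close> and
      \<open>1 - 1 / s\<close>. Multiplied by \<open>s\<close> and then by \<open>m powr s\<close>,
      it becomes the tangent inequality at \<open>m\<close>.\<close>
    have "((a / m) powr s) powr (1 / s) * 1 powr (1 - 1 / s)
        \<le> 1 / s * (a / m) powr s + (1 - 1 / s) * 1"
      by (rule Youngs_inequality_0) (use a m assms in auto)
    then have "a / m \<le> 1 / s * (a / m) powr s + (1 - 1 / s)"
      using a m assms by (simp add: powr_powr)
    then have "s * (a / m) \<le> s * (1 / s * (a / m) powr s + (1 - 1 / s))"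
      using assms by (intro mult_left_mono) auto
    then have "s * (a / m) \<le> (a / m) powr s + (s - 1)"
      using assms by (simp add: distrib_left right_diff_distrib)
    then have "m powr s * (s * (a / m)) \<le> m powr s * ((a / m) powr s + (s - 1))"
      by (intro mult_left_mono) auto
    then have "m powr s * s * (a / m) \<le> a powr s + m powr s * (s - 1)"
      using a m by (simp add: powr_divide distrib_left)
    moreover have "m powr s * s * (a / m) = s * m powr (s - 1) * a"
      using m by (simp add: ms)
    ultimately show ?thesis by (simp add: ms algebra_simps)
  qed
qed simp

lemma kernel_act_bounded:
  assumes K: "markov_kernel K" and f: "\<And>y. \<bar>f y\<bar> \<le> C"
  shows "(\<lambda>y. K x y * f y) summable_on UNIV" and "\<bar>kernel_act K f x\<bar> \<le> C"
proof -
  have K0: "0 \<le> K x y" and Ks: "(K x has_sum 1) UNIV" for y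
    using K by (auto simp: markov_kernel_def)
  have KC: "((\<lambda>y. K x y * C) has_sum C) UNIV"
    using has_sum_cmult_left[OF Ks, of C] by simp
  have le: "\<bar>K x y * f y\<bar> \<le> K x y * C" for y
    using f[of y] K0[of y] by (simp add: abs_mult mult_left_mono)
  show s: "(\<lambda>y. K x y * f y) summable_on UNIV"
    by (rule summable_on_dominated[OF has_sum_imp_summable[OF KC]]) (rule le)
  then show "\<bar>kernel_act K f x\<bar> \<le> C"
    using norm_infsum_le[OF has_sum_infsum[OF s] KC] le by (simp add: kernel_act_def)
qed

lemma kernel_act_diff_const:
  assumes K: "markov_kernel K" and f: "(\<lambda>y. K x y * f y) summable_on UNIV"
  shows "kernel_act K (\<lambda>y. f y - c) x = kernel_act K f x - c"
proof -
  have Ks: "(K x has_sum 1) UNIV" using K by (auto simp: markov_kernel_def)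
  have "((\<lambda>y. K x y * f y + K x y * (- c)) has_sum (kernel_act K f x + 1 * (- c))) UNIV"
    unfolding kernel_act_def by (intro has_sum_add has_sum_cmult_left has_sum_infsum f Ks)
  then have "((\<lambda>y. K x y * (f y - c)) has_sum (kernel_act K f x - c)) UNIV"
    by (simp add: right_diff_distrib)
  then show ?thesis by (simp add: kernel_act_def[of _ "\<lambda>y. f y - c"] infsumI)
qed

section \<open>Kernels with an invariant probability\<close>

text \<open>One time step in isolation: \<open>K\<close> stands for a single kernel of the
  environment and \<open>p\<close> for its normalized invariant measure.\<close>

locale stationary_kernel =
  fixes K :: "'a \<Rightarrow> 'a \<Rightarrow> real" and p :: "'a \<Rightarrow> real"
  assumes markov: "markov_kernel K"
    and pos: "0 < p x"
    and prob: "(p has_sum 1) UNIV"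
    and invariant: "measure_act p K = p"
begin

abbreviation integrable_p :: "('a \<Rightarrow> real) \<Rightarrow> bool" where
  "integrable_p f \<equiv> (\<lambda>x. f x * p x) summable_on UNIV"

section \<open>Integration against the invariant probability\<close>

lemma K_nonneg: "0 \<le> K x y" and K_le_1: "K x y \<le> 1" and K_sum: "(K x has_sum 1) UNIV"
  using markov by (auto simp: markov_kernel_def)

lemma p_nonneg: "0 \<le> p x"
  using pos[of x] by simp

lemma flow_has_sum: "((\<lambda>x. p x * K x y) has_sum p y) UNIV"
proof -
  have "(\<lambda>x. p x * K x y) summable_on UNIV"
    by (rule summable_on_dominated[OF has_sum_imp_summable[OF prob]])
       (use K_nonneg K_le_1 p_nonneg in \<open>auto simp: abs_mult mult_left_le\<close>)
  moreover have "(\<Sum>\<^sub>\<infinity>x. p x * K x y) = p y"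
    using fun_cong[OF invariant, of y] by (simp add: measure_act_def)
  ultimately show ?thesis by (simp add: has_sum_iff)
qed

lemma integrable_p_dominated:
  assumes "integrable_p g" "\<And>x. \<bar>f x\<bar> \<le> g x"
  shows "integrable_p f"
  by (rule summable_on_dominated[OF assms(1)])
     (use assms(2) p_nonneg in \<open>auto simp: abs_mult mult_right_mono\<close>)

lemma integrable_p_const: "integrable_p (\<lambda>_. c)"
  by (rule summable_on_cmult_right[OF has_sum_imp_summable[OF prob]])

lemma integrable_p_bounded: "(\<And>x. \<bar>f x\<bar> \<le> C) \<Longrightarrow> integrable_p f"
  by (rule integrable_p_dominated[OF integrable_p_const[of C]])

lemma integrable_p_add: "integrable_p f \<Longrightarrow> integrable_p g \<Longrightarrow> integrable_p (\<lambda>x. f x + g x)"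
  using summable_on_add[of "\<lambda>x. f x * p x" UNIV "\<lambda>x. g x * p x"] by (simp add: distrib_right)

lemma integrable_p_cmult: "integrable_p f \<Longrightarrow> integrable_p (\<lambda>x. c * f x)"
  using summable_on_cmult_right[of "\<lambda>x. f x * p x" UNIV c] by (simp add: mult_ac)

lemma l2_spaceD: "f \<in> l2_space p \<Longrightarrow> integrable_p (\<lambda>x. (f x)\<^sup>2)"
  by (simp add: l2_space_def)

lemma l2_imp_integrable: "f \<in> l2_space p \<Longrightarrow> integrable_p f"
proof (rule integrable_p_dominated[OF integrable_p_add[OF integrable_p_const[of 1] l2_spaceD]])
  fix x
  have "0 \<le> (\<bar>f x\<bar> - 1)\<^sup>2" by simp
  then show "\<bar>f x\<bar> \<le> 1 + (f x)\<^sup>2" by (simp add: power2_diff)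
qed

lemma bounded_imp_l2: "(\<And>x. \<bar>f x\<bar> \<le> C) \<Longrightarrow> f \<in> l2_space p"
  unfolding l2_space_def mem_Collect_eq
  by (rule integrable_p_bounded[of _ "C\<^sup>2"]) (simp add: abs_le_square_iff[symmetric] order_trans[OF _ abs_ge_self])

lemma mean_add: "integrable_p f \<Longrightarrow> integrable_p g \<Longrightarrow> mean p (\<lambda>x. f x + g x) = mean p f + mean p g"
  using infsum_add[of "\<lambda>x. f x * p x" UNIV "\<lambda>x. g x * p x"] by (simp add: mean_def distrib_right)

lemma mean_cmult: "mean p (\<lambda>x. c * f x) = c * mean p f"
  using infsum_cmult_right'[of c "\<lambda>x. f x * p x" UNIV] by (simp add: mean_def mult_ac)

lemma mean_const: "mean p (\<lambda>_. c) = c"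
  using mean_cmult[of c "\<lambda>_. 1"] infsumI[OF prob] by (simp add: mean_def)

lemma mean_mono: "integrable_p f \<Longrightarrow> integrable_p g \<Longrightarrow> (\<And>x. f x \<le> g x) \<Longrightarrow> mean p f \<le> mean p g"
  unfolding mean_def by (intro infsum_mono) (auto intro: mult_right_mono p_nonneg)

lemma mean_nonneg: "(\<And>x. 0 \<le> f x) \<Longrightarrow> 0 \<le> mean p f"
  unfolding mean_def by (intro infsum_nonneg) (simp add: p_nonneg)

lemma mean_eq_0D:
  assumes "integrable_p f" "\<And>x. 0 \<le> f x" "mean p f \<le> 0"
  shows "f x = 0"
proof -
  have "f x * p x = 0"
    by (rule nonneg_infsum_le_0D[of "\<lambda>x. f x * p x" UNIV])
       (use assms p_nonneg in \<open>auto simp: mean_def\<close>)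
  then show ?thesis using pos[of x] by simp
qed

lemma le_mean:
  assumes "integrable_p f" "\<And>x. 0 \<le> f x"
  shows "f x * p x \<le> mean p f"
  unfolding mean_def using finite_sum_le_infsum[OF assms(1), of "{x}"] assms(2) p_nonneg by simp

text \<open>Completing the square shows that the mean is the best constant approximation. This
  variational form allows variances under different measures to be compared.\<close>

lemma variance_le_mean_square:
  assumes f: "f \<in> l2_space p"
  shows "integrable_p (\<lambda>x. (f x - c)\<^sup>2)"
    and "mean p (\<lambda>x. (f x - c)\<^sup>2) = variance p f + (mean p f - c)\<^sup>2"
    and "variance p f \<le> mean p (\<lambda>x. (f x - c)\<^sup>2)"
proof -
  note i = l2_spaceD[OF f] l2_imp_integrable[OF f]
  have eq: "(f x - c)\<^sup>2 = (f x)\<^sup>2 + ((-2 * c) * f x + c\<^sup>2)" for x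
    by (auto simp: power2_diff)
  show "integrable_p (\<lambda>x. (f x - c)\<^sup>2)"
    unfolding eq by (intro integrable_p_add integrable_p_cmult integrable_p_const i)
  have "mean p (\<lambda>x. (f x - c)\<^sup>2) = mean p (\<lambda>x. (f x)\<^sup>2) + ((-2 * c) * mean p f + c\<^sup>2)"
    unfolding eq using i
    by (simp only: mean_add mean_const mean_cmult integrable_p_add integrable_p_cmult integrable_p_const)
  then show *: "mean p (\<lambda>x. (f x - c)\<^sup>2) = variance p f + (mean p f - c)\<^sup>2"
    by (simp add: variance_def power2_eq_square algebra_simps)
  then show "variance p f \<le> mean p (\<lambda>x. (f x - c)\<^sup>2)" by simp
qed

lemma variance_nonneg: "f \<in> l2_space p \<Longrightarrow> 0 \<le> variance p f"
  using variance_le_mean_square(2)[of f "mean p f"] mean_nonneg[of "\<lambda>x. (f x - mean p f)\<^sup>2"] by simp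

section \<open>Action of the kernel on integrable functions, and Jensen inequalities\<close>

text \<open>Fubini for \<open>p x * K x y * f y\<close>: by invariance the majorant sums over
  \<open>x\<close> to \<open>p y * \<bar>f y\<bar>\<close>, and the other order of summation gives
  preservation of the mean.\<close>

lemma kernel_act_integrable:
  assumes f: "integrable_p f"
  shows "(\<lambda>y. K x y * f y) summable_on UNIV"
    and "integrable_p (kernel_act K f)"
    and "mean p (kernel_act K f) = mean p f"
proof -
  let ?F = "\<lambda>x y. p x * K x y * f y" and ?w = "\<lambda>x y. p x * K x y * \<bar>f y\<bar>"
  have le: "\<bar>?F x y\<bar> \<le> ?w x y" for x y using p_nonneg K_nonneg by (simp add: abs_mult)
  have w: "((\<lambda>x. ?w x y) has_sum p y * \<bar>f y\<bar>) UNIV" for y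
    by (rule has_sum_cmult_left[OF flow_has_sum])
  have c: "(\<lambda>y. p y * \<bar>f y\<bar>) summable_on UNIV"
    using summable_on_iff_abs_summable_on_real[THEN iffD1, OF f] p_nonneg
    by (simp add: abs_mult mult.commute)
  note fub = fubini_dominated[of ?F ?w, OF le w c]
  have "(\<lambda>y. inverse (p x) * ?F x y) summable_on UNIV"
    by (rule summable_on_cmult_right[OF fub(1)])
  then show "(\<lambda>y. K x y * f y) summable_on UNIV"
    using pos[of x] by (simp add: mult.assoc[symmetric])
  have 1: "(\<Sum>\<^sub>\<infinity>y. ?F x y) = kernel_act K f x * p x" for x
    by (simp add: kernel_act_def mult.assoc infsum_cmult_right' mult.commute[of _ "p x"])
  have 2: "(\<Sum>\<^sub>\<infinity>x. ?F x y) = f y * p y" for y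
    using has_sum_cmult_left[OF flow_has_sum, of y "f y"] by (simp add: infsumI mult.commute)
  have "((\<lambda>x. kernel_act K f x * p x) has_sum mean p f) UNIV"
    using fub(2) unfolding 1 2 mean_def .
  then show "integrable_p (kernel_act K f)" "mean p (kernel_act K f) = mean p f"
    by (auto simp: has_sum_iff mean_def)
qed

lemma kernel_act_mono:
  assumes "integrable_p f" "integrable_p g" "\<And>y. f y \<le> g y"
  shows "kernel_act K f x \<le> kernel_act K g x"
  unfolding kernel_act_def
  by (intro infsum_mono kernel_act_integrable(1) assms mult_left_mono K_nonneg)

lemma kernel_act_nonneg: "(\<And>y. 0 \<le> f y) \<Longrightarrow> 0 \<le> kernel_act K f x"
  unfolding kernel_act_def by (intro infsum_nonneg) (simp add: K_nonneg)

text \<open>Integrating the supporting line against the probability \<open>K x\<close> kills its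
  linear term. Convexity enters only through a line of slope \<open>c\<close> at
  \<open>kernel_act K f x\<close>, which covers both squares on the real line and powers on the
  half-line.\<close>

lemma kernel_act_jensen:
  assumes f: "integrable_p f" and \<phi>: "integrable_p (\<lambda>y. \<phi> (f y))"
    and tangent: "\<And>y. \<phi> (kernel_act K f x) + c * (f y - kernel_act K f x) \<le> \<phi> (f y)"
  shows "\<phi> (kernel_act K f x) \<le> kernel_act K (\<lambda>y. \<phi> (f y)) x"
proof -
  let ?m = "kernel_act K f x"
  have "((\<lambda>y. K x y * (\<phi> ?m - c * ?m) + c * (K x y * f y)) has_sum
      (1 * (\<phi> ?m - c * ?m) + c * ?m)) UNIV"
    unfolding kernel_act_def
    by (intro has_sum_add has_sum_cmult_left has_sum_cmult_right K_sum has_sum_infsum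
        kernel_act_integrable(1) f)
  moreover have "((\<lambda>y. K x y * \<phi> (f y)) has_sum kernel_act K (\<lambda>y. \<phi> (f y)) x) UNIV"
    unfolding kernel_act_def by (intro has_sum_infsum kernel_act_integrable(1) \<phi>)
  ultimately have "1 * (\<phi> ?m - c * ?m) + c * ?m \<le> kernel_act K (\<lambda>y. \<phi> (f y)) x"
  proof (rule has_sum_mono)
    fix y
    have "K x y * (\<phi> ?m + c * (f y - ?m)) \<le> K x y * \<phi> (f y)"
      by (intro mult_left_mono tangent K_nonneg)
    then show "K x y * (\<phi> ?m - c * ?m) + c * (K x y * f y) \<le> K x y * \<phi> (f y)"
      by (simp add: algebra_simps)
  qed
  then show ?thesis by simp
qed

lemma kernel_act_square_le:
  assumes f: "f \<in> l2_space p"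
  shows "(kernel_act K f x)\<^sup>2 \<le> kernel_act K (\<lambda>y. (f y)\<^sup>2) x"
proof (rule kernel_act_jensen[where \<phi> = "\<lambda>u. u\<^sup>2" and c = "2 * kernel_act K f x"])
  fix y
  have "0 \<le> (f y - kernel_act K f x)\<^sup>2" by simp
  then show "(kernel_act K f x)\<^sup>2 + 2 * kernel_act K f x * (f y - kernel_act K f x) \<le> (f y)\<^sup>2"
    by (simp add: power2_eq_square algebra_simps)
qed (use f l2_imp_integrable l2_spaceD in auto)

lemma kernel_act_powr_le:
  assumes f: "\<And>y. 0 \<le> f y" "\<And>y. f y \<le> C" and s: "1 \<le> s"
  shows "kernel_act K f x powr s \<le> kernel_act K (\<lambda>y. f y powr s) x"
proof (rule kernel_act_jensen[where \<phi> = "\<lambda>u. u powr s"])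
  show "integrable_p f" by (rule integrable_p_bounded[of _ C]) (use f in auto)
  show "integrable_p (\<lambda>y. f y powr s)"
    by (rule integrable_p_bounded[of _ "C powr s"]) (use f s in \<open>auto intro: powr_mono2\<close>)
qed (use f s in \<open>auto intro!: powr_tangent kernel_act_nonneg\<close>)

lemma kernel_act_l2: "f \<in> l2_space p \<Longrightarrow> kernel_act K f \<in> l2_space p"
  unfolding l2_space_def mem_Collect_eq
  by (rule integrable_p_dominated[OF kernel_act_integrable(2)])
     (auto simp: l2_space_def intro: kernel_act_square_le)

section \<open>Adjoint, multiplicative symmetrization and Dirichlet form\<close>

lemma adjoint_eq: "l2_adjoint p K = (\<lambda>x y. p y * K y x / p x)"
  by (rule l2_adjoint_eq(1)[OF markov pos has_sum_imp_summable[OF prob] invariant])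

lemma mult_sym_act:
  assumes f: "f \<in> l2_space p"
  shows "kernel_act (mult_sym K p) f a = kernel_act (l2_adjoint p K) (kernel_act K f) a"
proof -
  let ?F = "\<lambda>z y. (p z * K z a / p a) * K z y * f y" and ?w = "\<lambda>z y. p z * K z y * (\<bar>f y\<bar> / p a)"
  \<comment> \<open>Bounding \<open>K z a\<close> by 1 leaves \<open>p z * K z y\<close>, whose sum
    over \<open>z\<close> is \<open>p y\<close> by invariance.\<close>
  have le: "\<bar>?F z y\<bar> \<le> ?w z y" for z y
  proof -
    have "\<bar>?F z y\<bar> = ?w z y * K z a"
      using p_nonneg K_nonneg by (simp add: abs_mult)
    also have "\<dots> \<le> ?w z y"
      using p_nonneg K_nonneg K_le_1 by (intro mult_left_le) auto
    finally show ?thesis .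
  qed
  have w: "((\<lambda>z. ?w z y) has_sum p y * (\<bar>f y\<bar> / p a)) UNIV" for y
    by (rule has_sum_cmult_left[OF flow_has_sum])
  have "(\<lambda>y. \<bar>f y * p y\<bar>) summable_on UNIV"
    using summable_on_iff_abs_summable_on_real[THEN iffD1, OF l2_imp_integrable[OF f]] by simp
  from summable_on_cmult_left[OF this, of "inverse (p a)"]
  have c: "(\<lambda>y. p y * (\<bar>f y\<bar> / p a)) summable_on UNIV"
    using p_nonneg by (simp add: abs_mult divide_inverse mult_ac)
  have "kernel_act (mult_sym K p) f a = (\<Sum>\<^sub>\<infinity>y. \<Sum>\<^sub>\<infinity>z. ?F z y)"
    by (simp only: kernel_act_def mult_sym_def kernel_comp_def adjoint_eq infsum_cmult_left')
  also have "\<dots> = (\<Sum>\<^sub>\<infinity>z. \<Sum>\<^sub>\<infinity>y. ?F z y)"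
    using fubini_dominated(2)[of ?F ?w, OF le w c] by (simp add: infsumI)
  also have "\<dots> = kernel_act (l2_adjoint p K) (kernel_act K f) a"
    by (simp only: kernel_act_def adjoint_eq mult.assoc infsum_cmult_right')
  finally show ?thesis .
qed

text \<open>The adjoint is the time reversal, so the two properties trade places: its rows sum to 1
  because \<open>p\<close> is invariant under \<open>K\<close>, and \<open>p\<close> is invariant
  under it because the rows of \<open>K\<close> sum to 1.\<close>

lemma stationary_adjoint: "stationary_kernel (l2_adjoint p K) p"
proof
  have flow_le: "p y * K y x \<le> p x" for x y
    using finite_sum_le_has_sum[OF flow_has_sum, of "{y}" x] p_nonneg K_nonneg by simp
  have "((\<lambda>y. p y * K y x * inverse (p x)) has_sum 1) UNIV" for x
    using has_sum_cmult_left[OF flow_has_sum, of x "inverse (p x)"] pos[of x] by simp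
  then show "markov_kernel (l2_adjoint p K)"
    using flow_le pos p_nonneg K_nonneg
    by (auto simp: markov_kernel_def adjoint_eq divide_inverse[symmetric] divide_le_eq_1)
  have "(\<Sum>\<^sub>\<infinity>x. p x * (p y * K y x / p x)) = p y" for y
  proof -
    have "(\<Sum>\<^sub>\<infinity>x. p x * (p y * K y x / p x)) = (\<Sum>\<^sub>\<infinity>x. p y * K y x)"
      using pos by (intro infsum_cong) (simp add: less_imp_neq[symmetric])
    also have "\<dots> = p y"
      using has_sum_cmult_right[OF K_sum, of "p y" y] by (simp add: infsumI)
    finally show ?thesis .
  qed
  then show "measure_act p (l2_adjoint p K) = p"
    by (simp add: measure_act_def adjoint_eq fun_eq_iff)
qed (use pos prob in auto)

lemma l2_mult_integrable:
  assumes "f \<in> l2_space p" "g \<in> l2_space p"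
  shows "integrable_p (\<lambda>x. f x * g x)"
proof (rule integrable_p_dominated[OF integrable_p_add])
  fix x
  have "0 \<le> (\<bar>f x\<bar> - \<bar>g x\<bar>)\<^sup>2" by simp
  then have "2 * \<bar>f x * g x\<bar> \<le> (f x)\<^sup>2 + (g x)\<^sup>2" by (simp add: power2_diff abs_mult)
  then show "\<bar>f x * g x\<bar> \<le> (f x)\<^sup>2 + (g x)\<^sup>2" by linarith
qed (use assms in \<open>auto simp: l2_space_def\<close>)

text \<open>Moving the adjoint across the inner product turns the form of \<open>K^*K\<close> into
  the loss of squared norm under \<open>K\<close>. Through this identity both functional
  inequalities become statements about one application of \<open>K\<close>.\<close>

lemma dirichlet_mult_sym:
  assumes f: "f \<in> l2_space p"
  shows "dirichlet_form (mult_sym K p) p f =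
    mean p (\<lambda>x. (f x)\<^sup>2) - mean p (\<lambda>x. (kernel_act K f x)\<^sup>2)"
proof -
  interpret adj: stationary_kernel "l2_adjoint p K" p by (rule stationary_adjoint)
  define g where "g = kernel_act (l2_adjoint p K) (kernel_act K f)"
  have Kf: "kernel_act K f \<in> l2_space p" by (rule kernel_act_l2[OF f])
  have g: "g \<in> l2_space p" unfolding g_def by (rule adj.kernel_act_l2[OF Kf])
  have "kernel_act (mult_sym K p) f = g"
    using mult_sym_act[OF f] by (auto simp: g_def)
  then have "dirichlet_form (mult_sym K p) p f = mean p (\<lambda>x. (f x)\<^sup>2 + (-1) * (f x * g x))"
    by (simp add: dirichlet_form_def l2_inner_def mean_def power2_eq_square algebra_simps)
  also have "\<dots> = mean p (\<lambda>x. (f x)\<^sup>2) + (-1) * mean p (\<lambda>x. f x * g x)"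
    unfolding mean_cmult[symmetric]
    by (intro mean_add integrable_p_cmult l2_mult_integrable l2_spaceD f g)
  also have "mean p (\<lambda>x. f x * g x) = l2_inner p (kernel_act K f) (kernel_act K f)"
    using l2_adjoint_eq(2)[OF markov pos has_sum_imp_summable[OF prob] invariant f Kf]
    by (simp add: mean_def l2_inner_def g_def)
  finally show ?thesis by (simp add: l2_inner_def mean_def power2_eq_square)
qed

text \<open>\<open>K\<close> preserves the mean, so the squared means cancel.\<close>

lemma dirichlet_eq_variance:
  assumes f: "f \<in> l2_space p"
  shows "dirichlet_form (mult_sym K p) p f = variance p f - variance p (kernel_act K f)"
  unfolding dirichlet_mult_sym[OF f] variance_def kernel_act_integrable(3)[OF l2_imp_integrable[OF f]]
  by simp

lemma dirichlet_nonneg: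
  assumes f: "f \<in> l2_space p"
  shows "0 \<le> dirichlet_form (mult_sym K p) p f"
proof -
  have "mean p (\<lambda>x. (kernel_act K f x)\<^sup>2) \<le> mean p (kernel_act K (\<lambda>x. (f x)\<^sup>2))"
    by (intro mean_mono kernel_act_integrable l2_spaceD kernel_act_l2 kernel_act_square_le f)
  also have "\<dots> = mean p (\<lambda>x. (f x)\<^sup>2)" by (rule kernel_act_integrable(3)[OF l2_spaceD[OF f]])
  finally show ?thesis by (simp add: dirichlet_mult_sym[OF f])
qed

end

section \<open>Poincare and logarithmic Sobolev constants\<close>

text \<open>\<open>Greatest\<close> is a definite description and is meaningful only if a maximum
  exists. For a nonempty closed set bounded above, the supremum is such a maximum.\<close>

lemma Greatest_closed:
  fixes P :: "real \<Rightarrow> bool"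
  assumes "closed {x. P x}" "P a" "\<And>x. P x \<Longrightarrow> x \<le> b"
  shows "P (Greatest P)"
proof -
  let ?s = "Sup {x. P x}"
  have bdd: "bdd_above {x. P x}" using assms(3) by (intro bdd_aboveI) auto
  have "P ?s" using closed_contains_Sup[OF _ bdd assms(1)] assms(2) by auto
  moreover have up: "z \<le> ?s" if "P z" for z using cSup_upper[OF _ bdd] that by simp
  ultimately have "Greatest P = ?s" by (rule Greatest_equality)
  then show ?thesis using \<open>P ?s\<close> by simp
qed

lemma has_sum_ereal:
  "(f has_sum s) A \<Longrightarrow> ((\<lambda>x. ereal (f x)) has_sum ereal s) A"
  unfolding has_sum_def using tendsto_ereal[of "sum f"] by (simp add: sum_ereal[abs_def])

text \<open>The two sides come from \<open>ln u \<le> u - 1\<close> at \<open>u = v\<close> and at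
  \<open>u = 1 / v\<close>. The bound makes the entropy integrand of a bounded function
  bounded.\<close>

lemma abs_mult_ln_le:
  fixes v :: real
  assumes "0 \<le> v"
  shows "\<bar>v * ln v\<bar> \<le> 1 + v\<^sup>2"
proof (cases "v = 0")
  case False
  then have v: "0 < v" using assms by simp
  have "v * ln v \<le> v * (v - 1)"
    using v ln_le_minus_one[of v] by (intro mult_left_mono) auto
  moreover have "v * (1 - 1 / v) \<le> v * ln v"
    using v ln_le_minus_one[of "1 / v"] by (intro mult_left_mono) (auto simp: ln_div)
  then have "v - 1 \<le> v * ln v" using v by (simp add: right_diff_distrib)
  ultimately have "v * ln v \<le> v\<^sup>2 - v" "v - 1 \<le> v * ln v"
    by (auto simp: power2_eq_square right_diff_distrib)
  then show ?thesis using v zero_le_power2[of v] unfolding abs_le_iff by linarith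
qed simp

context stationary_kernel
begin

lemma mean_supported_at:
  assumes "\<And>x. x \<noteq> a \<Longrightarrow> g x = 0"
  shows "mean p g = g a * p a"
  unfolding mean_def
  using infsum_cong_neutral[of "{a}" UNIV "\<lambda>x. g x * p x" "\<lambda>x. g x * p x"] assms by simp

lemma p_less_1:
  assumes "\<exists>a b :: 'a. a \<noteq> b"
  shows "p a < 1"
proof -
  obtain b where b: "b \<noteq> a" using assms by metis
  have "sum p {a, b} \<le> 1"
    by (rule finite_sum_le_has_sum[OF prob]) (use p_nonneg in auto)
  then show ?thesis using b pos[of b] by simp
qed

text \<open>For bounded functions the extended-real entropy is an ordinary mean, after which only
  real arithmetic is needed.\<close>

lemma entropy_bounded:
  assumes f: "\<And>x. 0 \<le> f x" "\<And>x. f x \<le> C" and m: "0 < mean p f"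
  shows "integrable_p (\<lambda>x. f x * ln (f x / mean p f))"
    and "entropy p f = ereal (mean p (\<lambda>x. f x * ln (f x / mean p f)))"
proof -
  let ?m = "mean p f" and ?g = "\<lambda>x. f x * ln (f x / mean p f)"
  have "\<bar>?g x\<bar> \<le> ?m * (1 + (C / ?m)\<^sup>2)" for x
  proof -
    have "\<bar>?g x\<bar> = ?m * \<bar>f x / ?m * ln (f x / ?m)\<bar>" using m by (simp add: abs_mult)
    also have "\<dots> \<le> ?m * (1 + (f x / ?m)\<^sup>2)"
      using m f by (intro mult_left_mono abs_mult_ln_le) auto
    also have "\<dots> \<le> ?m * (1 + (C / ?m)\<^sup>2)"
      using m f by (intro mult_left_mono add_left_mono power_mono divide_right_mono) auto
    finally show ?thesis .
  qed
  then show i: "integrable_p ?g" by (rule integrable_p_bounded)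
  show "entropy p f = ereal (mean p ?g)"
    unfolding entropy_def mean_def[of _ ?g] by (intro infsumI has_sum_ereal has_sum_infsum i)
qed

section \<open>The Poincare and logarithmic Sobolev constants are attained\<close>

lemma poincare:
  assumes nontrivial: "\<exists>a b :: 'a. a \<noteq> b"
  shows "f \<in> l2_space p \<Longrightarrow>
      poincare_const (mult_sym K p) p * variance p f \<le> dirichlet_form (mult_sym K p) p f"
    and "poincare_const (mult_sym K p) p \<le> 1"
proof -
  let ?D = "dirichlet_form (mult_sym K p) p"
  let ?P = "\<lambda>\<gamma>. \<forall>f\<in>l2_space p. \<gamma> * variance p f \<le> ?D f"
  have "{\<gamma>. ?P \<gamma>} = (\<Inter>f\<in>l2_space p. {\<gamma>. \<gamma> * variance p f \<le> ?D f})" by auto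
  also have "closed \<dots>" by (intro closed_INT ballI closed_Collect_le continuous_intros)
  finally have closed: "closed {\<gamma>. ?P \<gamma>}" .
  have P0: "?P 0" using dirichlet_nonneg by simp
  have le_1: "\<gamma> \<le> 1" if "?P \<gamma>" for \<gamma>
  proof -
    \<comment> \<open>The indicator of a point is the test function: its variance
      \<open>p a * (1 - p a)\<close> is positive because there is a second point, and the Dirichlet
      form never exceeds the variance.\<close>
    fix a :: 'a
    define i :: "'a \<Rightarrow> real" where "i x = (if x = a then 1 else 0)" for x
    have i: "i \<in> l2_space p" by (rule bounded_imp_l2[of _ 1]) (simp add: i_def)
    have "variance p i = p a - (p a)\<^sup>2"
      unfolding variance_def by (simp add: mean_supported_at[of a] i_def)
    also have "\<dots> = p a * (1 - p a)" by (simp add: power2_eq_square algebra_simps)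
    also have "\<dots> > 0" using pos[of a] p_less_1[OF nontrivial, of a] by simp
    finally have v: "0 < variance p i" .
    have "\<gamma> * variance p i \<le> ?D i" using that i by blast
    also have "\<dots> \<le> 1 * variance p i"
      using dirichlet_eq_variance[OF i] variance_nonneg[OF kernel_act_l2[OF i]] by simp
    finally show ?thesis using v by (simp only: mult_le_cancel_right_pos)
  qed
  note G = Greatest_closed[of ?P, OF closed P0 le_1]
  then show "f \<in> l2_space p \<Longrightarrow> poincare_const (mult_sym K p) p * variance p f \<le> ?D f"
    unfolding poincare_const_def by blast
  show "poincare_const (mult_sym K p) p \<le> 1"
    unfolding poincare_const_def by (rule le_1[OF G])
qed

lemma variance_kernel_act_le:
  assumes nontrivial: "\<exists>a b :: 'a. a \<noteq> b" and f: "f \<in> l2_space p"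
  shows "variance p (kernel_act K f) \<le> (1 - poincare_const (mult_sym K p) p) * variance p f"
  using poincare(1)[OF assms] dirichlet_eq_variance[OF f] by (simp add: left_diff_distrib)

lemma log_sobolev:
  assumes nontrivial: "\<exists>a b :: 'a. a \<noteq> b"
  shows "0 \<le> log_sobolev_const (mult_sym K p) p"
    and "\<lbrakk>f \<in> l2_space p; \<And>x. 0 \<le> f x; \<not> f constant_on UNIV\<rbrakk> \<Longrightarrow>
      ereal (log_sobolev_const (mult_sym K p) p) * entropy p (\<lambda>x. (f x)\<^sup>2)
        \<le> ereal (dirichlet_form (mult_sym K p) p f)"
proof -
  let ?D = "dirichlet_form (mult_sym K p) p"
  let ?A = "{f \<in> l2_space p. (\<forall>x. 0 \<le> f x) \<and> \<not> f constant_on UNIV}"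
  let ?P = "\<lambda>\<alpha>. 0 \<le> \<alpha> \<and> (\<forall>f\<in>l2_space p. (\<forall>x. 0 \<le> f x) \<and> \<not> f constant_on UNIV \<longrightarrow>
           ereal \<alpha> * entropy p (\<lambda>x. (f x)\<^sup>2) \<le> ereal (?D f))"
  \<comment> \<open>The shape depends on the extended value \<open>e\<close>: a closed condition on
    the half-line if it is finite, only 0 if it is \<infinity> since 0 times \<infinity> is 0, and
    the whole half-line if it is minus \<infinity>.\<close>
  have cl: "closed {\<alpha>. 0 \<le> \<alpha> \<and> ereal \<alpha> * e \<le> ereal d}" if d: "0 \<le> d" for e d
  proof (cases e)
    case (real e')
    then show ?thesis
      by (auto intro!: closed_Collect_conj closed_Collect_le continuous_intros)
  next
    case PInf
    then have "{\<alpha>. 0 \<le> \<alpha> \<and> ereal \<alpha> * e \<le> ereal d} = {0}"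
      using d by (auto simp: ereal_mult_eq_PInfty zero_ereal_def[symmetric]) 
    then show ?thesis by simp
  next
    case MInf
    then have "{\<alpha>. 0 \<le> \<alpha> \<and> ereal \<alpha> * e \<le> ereal d} = {0..}"
      using d by (auto simp: zero_ereal_def[symmetric])
    then show ?thesis by simp
  qed
  have "{\<alpha>. ?P \<alpha>} = {0..} \<inter>
      (\<Inter>f\<in>?A. {\<alpha>. 0 \<le> \<alpha> \<and> ereal \<alpha> * entropy p (\<lambda>x. (f x)\<^sup>2) \<le> ereal (?D f)})" by auto
  also have "closed \<dots>" using dirichlet_nonneg by (intro closed_Int closed_INT ballI cl) auto
  finally have closed: "closed {\<alpha>. ?P \<alpha>}" .
  have P0: "?P 0" using dirichlet_nonneg by (simp add: zero_ereal_def[symmetric])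
  \<comment> \<open>The indicator of a point has finite positive entropy, which bounds every
    admissible constant from above.\<close>
  fix a :: 'a
  define i :: "'a \<Rightarrow> real" where "i x = (if x = a then 1 else 0)" for x
  have i: "i \<in> l2_space p" by (rule bounded_imp_l2[of _ 1]) (simp add: i_def)
  have i2: "(i x)\<^sup>2 = i x" for x by (simp add: i_def)
  have mi: "mean p i = p a" by (simp add: mean_supported_at[of a] i_def)
  have "entropy p (\<lambda>x. (i x)\<^sup>2) = ereal (mean p (\<lambda>x. i x * ln (i x / mean p i)))"
    unfolding i2 by (rule entropy_bounded(2)[where C = 1]) (auto simp: mi pos, auto simp: i_def)
  also have "mean p (\<lambda>x. i x * ln (i x / mean p i)) = ln (1 / p a) * p a"
    by (simp add: mean_supported_at[of a] i_def mi)
  finally have ent: "entropy p (\<lambda>x. (i x)\<^sup>2) = ereal (ln (1 / p a) * p a)" .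
  have epos: "0 < ln (1 / p a) * p a"
    using pos[of a] p_less_1[OF nontrivial, of a] by (intro mult_pos_pos ln_gt_zero) auto
  obtain b where "b \<noteq> a" using nontrivial by metis
  then have "i a \<noteq> i b" by (simp add: i_def)
  then have nc: "\<not> i constant_on UNIV" by (metis constant_on_def UNIV_I)
  have bound: "\<alpha> \<le> ?D i / (ln (1 / p a) * p a)" if "?P \<alpha>" for \<alpha>
  proof -
    have "\<forall>x. 0 \<le> i x" by (simp add: i_def)
    then have "ereal \<alpha> * entropy p (\<lambda>x. (i x)\<^sup>2) \<le> ereal (?D i)"
      using that i nc by blast
    then show ?thesis using epos by (simp add: ent pos_le_divide_eq)
  qed
  note G = Greatest_closed[of ?P, OF closed P0 bound]
  then show "0 \<le> log_sobolev_const (mult_sym K p) p"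
    unfolding log_sobolev_const_def by blast
  show "\<lbrakk>f \<in> l2_space p; \<And>x. 0 \<le> f x; \<not> f constant_on UNIV\<rbrakk> \<Longrightarrow>
      ereal (log_sobolev_const (mult_sym K p) p) * entropy p (\<lambda>x. (f x)\<^sup>2) \<le> ereal (?D f)"
    using G unfolding log_sobolev_const_def by blast
qed

text \<open>The definition of the constant tests only non-constant functions. For constants the
  entropy vanishes and the right-hand side is nonnegative, so the inequality extends to
  them.\<close>

lemma log_sobolev_bounded:
  assumes nontrivial: "\<exists>a b :: 'a. a \<noteq> b"
    and f: "\<And>x. 0 \<le> f x" "\<And>x. f x \<le> C" and m: "0 < mean p (\<lambda>x. (f x)\<^sup>2)"
  shows "log_sobolev_const (mult_sym K p) p *
      mean p (\<lambda>x. (f x)\<^sup>2 * ln ((f x)\<^sup>2 / mean p (\<lambda>x. (f x)\<^sup>2)))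
    \<le> mean p (\<lambda>x. (f x)\<^sup>2) - mean p (\<lambda>x. (kernel_act K f x)\<^sup>2)"
proof -
  have l2: "f \<in> l2_space p" by (rule bounded_imp_l2[of _ C]) (use f in auto)
  have C2: "(f x)\<^sup>2 \<le> C\<^sup>2" for x using f by (intro power_mono) auto
  show ?thesis
  proof (cases "f constant_on UNIV")
    case True
    then obtain c where "f x = c" for x by (auto simp: constant_on_def)
    then have "mean p (\<lambda>x. (f x)\<^sup>2 * ln ((f x)\<^sup>2 / mean p (\<lambda>x. (f x)\<^sup>2))) = 0"
      by (simp add: mean_const)
    then show ?thesis using dirichlet_nonneg[OF l2] by (simp add: dirichlet_mult_sym[OF l2])
  next
    case False
    then show ?thesis
      using log_sobolev(2)[OF nontrivial l2 f(1)] entropy_bounded(2)[OF _ C2 m]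
      by (simp add: dirichlet_mult_sym[OF l2])
  qed
qed

section \<open>Hypercontractivity from the logarithmic Sobolev inequality\<close>

text \<open>One application of \<open>K\<close> gains the factor \<open>1 + \<alpha>\<close> in the exponent. With \<open>F = p (f powr s)\<close>
  and \<open>E\<close> the entropy of \<open>f powr s\<close>, Jensen and the logarithmic Sobolev inequality for
  \<open>f powr (s/2)\<close> give \<open>p ((K f) powr s) \<le> F - \<alpha> E \<le> F exp (- \<alpha> E / F)\<close>, whereas Jensen for
  the probability \<open>f powr s * p / F\<close> gives \<open>F exp ((q - s) / s * (E / F + ln F)) \<le> p (f powr q)\<close>.\<close>

lemma hypercontractive:
  assumes nontrivial: "\<exists>a b :: 'a. a \<noteq> b"
    and f: "\<And>x. 0 \<le> f x" "\<And>x. f x \<le> C"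
    and q: "2 \<le> q" and s: "s = q * (1 + log_sobolev_const (mult_sym K p) p)"
  shows "mean p (\<lambda>x. kernel_act K f x powr s) powr (1 / s) \<le> mean p (\<lambda>x. f x powr q) powr (1 / q)"
proof -
  define \<alpha> where "\<alpha> = log_sobolev_const (mult_sym K p) p"
  have \<alpha>: "0 \<le> \<alpha>" unfolding \<alpha>_def by (rule log_sobolev(1)[OF nontrivial])
  have s: "s = q * (1 + \<alpha>)" using s by (simp add: \<alpha>_def)
  have sq: "q \<le> s" using q \<alpha> mult_left_mono[of 1 "1 + \<alpha>" q] by (simp add: s)
  have bd: "0 \<le> f x powr e" "f x powr e \<le> C powr e" "\<bar>f x powr e\<bar> \<le> C powr e" if "0 \<le> e" for e x
    using f that by (auto intro: powr_mono2)
  have int: "integrable_p (\<lambda>x. f x powr e)" if "0 \<le> e" for e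
    by (rule integrable_p_bounded) (rule bd(3)[OF that])
  have Kbd: "0 \<le> kernel_act K f x" "kernel_act K f x \<le> C" for x
    using kernel_act_nonneg[of f, OF f(1)] kernel_act_bounded(2)[OF markov, of f C x] f
    by (auto simp: abs_le_iff)
  define F where "F = mean p (\<lambda>x. f x powr s)"
  define G where "G = mean p (\<lambda>x. kernel_act K f x powr s)"
  define H where "H = mean p (\<lambda>x. f x powr q)"
  define E where "E = mean p (\<lambda>x. f x powr s * ln (f x powr s / F))"
  have F0: "0 \<le> F" unfolding F_def by (rule mean_nonneg) simp
  have half: "(f x powr (s / 2))\<^sup>2 = f x powr s" for x
    by (simp add: power2_eq_square powr_add[symmetric])
  have G: "G \<le> mean p (\<lambda>x. (kernel_act K (\<lambda>y. f y powr (s / 2)) x)\<^sup>2)"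
    unfolding G_def
  proof (rule mean_mono)
    show "integrable_p (\<lambda>x. kernel_act K f x powr s)"
      by (rule integrable_p_bounded[of _ "C powr s"]) (use Kbd q sq in \<open>auto intro: powr_mono2\<close>)
    show "integrable_p (\<lambda>x. (kernel_act K (\<lambda>y. f y powr (s / 2)) x)\<^sup>2)"
      by (intro l2_spaceD kernel_act_l2 bounded_imp_l2[of _ "C powr (s / 2)"] bd(3))
         (use q sq in auto)
    fix x
    have "kernel_act K f x powr (s / 2) \<le> kernel_act K (\<lambda>y. f y powr (s / 2)) x"
      by (rule kernel_act_powr_le[OF f]) (use q sq in auto)
    then have "(kernel_act K f x powr (s / 2))\<^sup>2 \<le> (kernel_act K (\<lambda>y. f y powr (s / 2)) x)\<^sup>2"
      by (intro power_mono) auto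
    then show "kernel_act K f x powr s \<le> (kernel_act K (\<lambda>y. f y powr (s / 2)) x)\<^sup>2"
      by (simp add: power2_eq_square powr_add[symmetric])
  qed
  have G0: "0 \<le> G" unfolding G_def by (rule mean_nonneg) simp
  show ?thesis
  proof (cases "F = 0")
    case True
    \<comment> \<open>Every point has positive mass, so a vanishing mean forces \<open>f\<close> to
      vanish everywhere, and both sides are 0.\<close>
    have "f x powr s = 0" for x
      by (rule mean_eq_0D[of "\<lambda>x. f x powr s"]) (use int[of s] q sq True in \<open>auto simp: F_def\<close>)
    then have "f x = 0" for x by simp
    then show ?thesis using q sq by (simp add: kernel_act_def mean_const)
  next
    case False
    then have Fpos: "0 < F" using F0 by simp
    have "\<alpha> * E \<le> F - mean p (\<lambda>x. (kernel_act K (\<lambda>y. f y powr (s / 2)) x)\<^sup>2)"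
      using log_sobolev_bounded[OF nontrivial, of "\<lambda>x. f x powr (s / 2)" "C powr (s / 2)"]
        bd[of "s / 2"] Fpos q sq
      unfolding half F_def[symmetric] E_def[symmetric] \<alpha>_def[symmetric] by simp
    then have "G \<le> F - \<alpha> * E" using G by simp
    also have "\<dots> = F * (1 + (- (\<alpha> * E / F)))" using Fpos by (simp add: field_simps)
    also have "\<dots> \<le> F * exp (- (\<alpha> * E / F))"
      using Fpos by (intro mult_left_mono exp_ge_add_one_self) auto
    finally have GF: "G \<le> F * exp (- (\<alpha> * E / F))" .
    \<comment> \<open>With this \<open>d\<close>, \<open>f powr (q - s)\<close> is
      \<open>(f powr s) powr d\<close> where \<open>f\<close> is positive. The number
      \<open>c\<close> is its geometric mean under the probability \<open>f powr s * p / F\<close>,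
      since \<open>E / F + ln F\<close> is the mean of \<open>ln (f powr s)\<close> there.\<close>
    define d where "d = (q - s) / s"
    define c where "c = exp (d * (E / F + ln F))"
    define L where "L x = f x powr s * ln (f x powr s / F)" for x
    have iL: "integrable_p L"
      using entropy_bounded(1)[of "\<lambda>x. f x powr s" "C powr s"] bd[of s] Fpos q sq
      unfolding F_def[symmetric] L_def[abs_def] by simp
    have is_int: "integrable_p (\<lambda>x. f x powr s)" using int q sq by simp
    \<comment> \<open>The right-hand side is the integral, with weight \<open>f powr s * p\<close>,
      of the tangent to \<open>exp\<close> at \<open>ln c\<close> evaluated at
      \<open>ln (f powr (q - s))\<close>. The choice of \<open>c\<close> makes it equal to
      \<open>c * F\<close>, and convexity of \<open>exp\<close> bounds it by
      \<open>H\<close>.\<close>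
    have "c * F = (c * d) * E + (c * (1 + d * ln F - ln c)) * F"
      using Fpos by (simp add: c_def field_simps)
    also have "\<dots> = mean p (\<lambda>x. (c * d) * L x + (c * (1 + d * ln F - ln c)) * f x powr s)"
      unfolding mean_add[OF integrable_p_cmult[OF iL] integrable_p_cmult[OF is_int]] mean_cmult
      by (simp add: E_def F_def L_def[abs_def])
    also have "\<dots> \<le> H"
      unfolding H_def
    proof (rule mean_mono)
      show "integrable_p (\<lambda>x. f x powr q)" using int q by simp
      show "integrable_p (\<lambda>x. (c * d) * L x + (c * (1 + d * ln F - ln c)) * f x powr s)"
        by (intro integrable_p_add integrable_p_cmult iL is_int)
      fix x
      show "(c * d) * L x + (c * (1 + d * ln F - ln c)) * f x powr s \<le> f x powr q"
      proof (cases "f x = 0")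
        case False
        then have fx: "0 < f x" using f(1)[of x] by simp
        have "1 + (ln (f x powr (q - s)) - ln c) \<le> exp (ln (f x powr (q - s)) - ln c)"
          by (rule exp_ge_add_one_self)
        also have "\<dots> = f x powr (q - s) / c" using fx by (simp add: exp_diff c_def powr_def)
        finally have "1 + ((q - s) * ln (f x) - ln c) \<le> f x powr (q - s) / c"
          using fx by (simp add: ln_powr)
        then have "(c * f x powr s) * (1 + ((q - s) * ln (f x) - ln c))
            \<le> (c * f x powr s) * (f x powr (q - s) / c)"
          by (intro mult_left_mono) (auto simp: c_def)
        also have "\<dots> = f x powr q" using fx by (simp add: c_def powr_diff)
        also have "(q - s) * ln (f x) = d * (ln (f x powr s / F) + ln F)"
          using fx Fpos q sq by (simp add: d_def ln_div ln_powr)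
        finally show ?thesis by (simp add: L_def algebra_simps)
      qed (simp add: L_def)
    qed
    finally have cFH: "c * F \<le> H" .
    have "G powr (1 / s) \<le> (F * exp (- (\<alpha> * E / F))) powr (1 / s)"
      using GF G0 q sq by (intro powr_mono2) auto
    also have "\<dots> = (c * F) powr (1 / q)"
    proof -
      \<comment> \<open>Here the relation \<open>s = q * (1 + \<alpha>)\<close> is decisive: it
        matches the coefficients of both \<open>E / F\<close> and \<open>ln F\<close>, so the two
        bounds meet with equality.\<close>
      have d: "d / q = - (\<alpha> / s)" "d / q + 1 / q = 1 / s"
        using q sq by (simp_all add: d_def s divide_simps) (simp_all add: algebra_simps)
      have "ln F / s + - (\<alpha> * E / F) / s = (d / q) * (E / F) + (d / q + 1 / q) * ln F"
        unfolding d(2) unfolding d(1) by (simp add: mult.commute)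
      then have "(ln F + - (\<alpha> * E / F)) * (1 / s) = (d * (E / F + ln F) + ln F) * (1 / q)"
        by (simp add: algebra_simps add_divide_distrib diff_divide_distrib)
      then show ?thesis
        using Fpos by (simp add: powr_def c_def ln_mult mult.commute)
    qed
    also have "\<dots> \<le> H powr (1 / q)"
      using cFH Fpos q by (intro powr_mono2) (auto simp: c_def)
    finally show ?thesis unfolding G_def H_def .
  qed
qed

end

section \<open>Non-decreasing environments\<close>

text \<open>\<open>kernel_chain K r n f\<close> is \<open>K\<^sub>r\<^sub>+\<^sub>1 \<dots> K\<^sub>r\<^sub>+\<^sub>n f\<close>.\<close>

primrec kernel_chain ::
    "(nat \<Rightarrow> 'a \<Rightarrow> 'a \<Rightarrow> real) \<Rightarrow> nat \<Rightarrow> nat \<Rightarrow> ('a \<Rightarrow> real) \<Rightarrow> 'a \<Rightarrow> real" where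
  "kernel_chain K r 0 f = f"
| "kernel_chain K r (Suc n) f = kernel_chain K r n (kernel_act (K (r + n + 1)) f)"

lemma kernel_chain_add:
  "kernel_chain K r (m + n) f = kernel_chain K r m (kernel_chain K (r + m) n f)"
  by (induction n arbitrary: f) (simp_all add: add.assoc)

lemma sqrt_prod: "sqrt (\<Prod>i\<in>A. f i) = (\<Prod>i\<in>A. sqrt (f i))"
  by (induction A rule: infinite_finite_induct) (simp_all add: real_sqrt_mult)

lemma Inf_enat_image_in: "S \<noteq> {} \<Longrightarrow> Inf (enat ` S) \<in> enat ` S"
  by (metis wellorder_InfI ex_in_conv image_is_empty)

locale merging_env =
  fixes K :: "nat \<Rightarrow> 'a \<Rightarrow> 'a \<Rightarrow> real" and \<pi> :: "nat \<Rightarrow> 'a \<Rightarrow> real"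
  assumes nontrivial: "\<exists>a b :: 'a. a \<noteq> b"
    and markov: "1 \<le> t \<Longrightarrow> markov_kernel (K t)"
    and env: "finite_nondecreasing_env K \<pi>"
begin

section \<open>Masses, normalization and monotonicity in time\<close>

lemma \<pi>_pos: "1 \<le> t \<Longrightarrow> 0 < \<pi> t x"
  and \<pi>_summable: "1 \<le> t \<Longrightarrow> \<pi> t summable_on UNIV"
  and \<pi>_mono: "1 \<le> t \<Longrightarrow> \<pi> t x \<le> \<pi> (Suc t) x"
  using env by (auto simp: finite_nondecreasing_env_def)

lemma mass_pos: "1 \<le> t \<Longrightarrow> 0 < total_mass (\<pi> t)"
  using finite_sum_le_infsum[OF \<pi>_summable, of t "{undefined}"] \<pi>_pos[of t]
  by (force simp: total_mass_def less_imp_le intro: less_le_trans)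

lemma mass_mono: "1 \<le> t \<Longrightarrow> total_mass (\<pi> t) \<le> total_mass (\<pi> (Suc t))"
  unfolding total_mass_def by (intro infsum_mono \<pi>_summable \<pi>_mono) auto

lemma mass_ge_1: "1 \<le> t \<Longrightarrow> total_mass (\<pi> 1) \<le> total_mass (\<pi> t)"
proof (induction t rule: dec_induct)
  case (step t)
  then show ?case using mass_mono[of t] by simp
qed simp

lemma stationary:
  assumes t: "1 \<le> t"
  shows "stationary_kernel (K t) (normalized (\<pi> t))"
proof
  note m = mass_pos[OF t]
  show "0 < normalized (\<pi> t) x" for x using \<pi>_pos[OF t] m by (simp add: normalized_def)
  have "((\<lambda>x. \<pi> t x * inverse (total_mass (\<pi> t))) has_sum
      total_mass (\<pi> t) * inverse (total_mass (\<pi> t))) UNIV"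
    unfolding total_mass_def by (intro has_sum_cmult_left has_sum_infsum \<pi>_summable t)
  then show "(normalized (\<pi> t) has_sum 1) UNIV"
    using m by (simp add: normalized_def[abs_def] divide_inverse)
  have "measure_act (\<pi> t) (K t) y = \<pi> t y" for y
    using env t by (simp add: finite_nondecreasing_env_def)
  then show "measure_act (normalized (\<pi> t)) (K t) = normalized (\<pi> t)"
    by (simp add: fun_eq_iff measure_act_def normalized_def divide_inverse
        mult.commute[of _ "inverse _"] mult.assoc infsum_cmult_right')
qed (rule markov[OF t])

text \<open>Integrals against \<open>\<pi> t\<close> itself are monotone in time, while normalized
  means need not be. The total mass is therefore carried as an explicit factor.\<close>

lemma mass_mean:
  assumes t: "1 \<le> t"
  shows "total_mass (\<pi> t) * mean (normalized (\<pi> t)) f = (\<Sum>\<^sub>\<infinity>x. f x * \<pi> t x)"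
  unfolding mean_def infsum_cmult_right'[symmetric]
  using mass_pos[OF t] by (intro infsum_cong) (simp add: normalized_def)

lemma summable_iff_normalized:
  assumes t: "1 \<le> t"
  shows "(\<lambda>x. f x * \<pi> t x) summable_on UNIV \<longleftrightarrow> (\<lambda>x. f x * normalized (\<pi> t) x) summable_on UNIV"
  using mass_pos[OF t] summable_on_cmult_left'[of "inverse (total_mass (\<pi> t))" "\<lambda>x. f x * \<pi> t x" UNIV]
  by (simp add: normalized_def divide_inverse mult.assoc)

lemma mass_mean_mono:
  assumes t: "1 \<le> t" and f: "\<And>x. 0 \<le> f x" "\<And>x. f x \<le> C"
  shows "total_mass (\<pi> t) * mean (normalized (\<pi> t)) f
    \<le> total_mass (\<pi> (Suc t)) * mean (normalized (\<pi> (Suc t))) f"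
proof -
  have s: "(\<lambda>x. f x * \<pi> u x) summable_on UNIV" if "1 \<le> u" for u
    unfolding summable_iff_normalized[OF that]
    by (rule stationary_kernel.integrable_p_bounded[OF stationary[OF that], of _ C])
       (use f in auto)
  have "(\<Sum>\<^sub>\<infinity>x. f x * \<pi> t x) \<le> (\<Sum>\<^sub>\<infinity>x. f x * \<pi> (Suc t) x)"
    using t f by (intro infsum_mono s mult_left_mono \<pi>_mono) auto
  then show ?thesis using t by (simp add: mass_mean)
qed

lemma kernel_act_bound:
  "1 \<le> t \<Longrightarrow> (\<And>x. \<bar>f x\<bar> \<le> C) \<Longrightarrow> \<bar>kernel_act (K t) f x\<bar> \<le> C"
  by (rule kernel_act_bounded(2)[OF markov])

lemma kernel_chain_bound:
  "(\<And>x. \<bar>f x\<bar> \<le> C) \<Longrightarrow> \<bar>kernel_chain K r n f x\<bar> \<le> C"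
proof (induction n arbitrary: f x)
  case (Suc n)
  show ?case using Suc.IH[OF kernel_act_bound[OF _ Suc.prems]] by simp
qed simp

lemma kernel_chain_diff_const:
  "(\<And>x. \<bar>f x\<bar> \<le> C) \<Longrightarrow> kernel_chain K r n (\<lambda>y. f y - c) x = kernel_chain K r n f x - c"
proof (induction n arbitrary: f)
  case (Suc n)
  have "kernel_act (K (r + n + 1)) (\<lambda>y. f y - c) = (\<lambda>x. kernel_act (K (r + n + 1)) f x - c)"
    using kernel_act_diff_const[OF markov kernel_act_bounded(1)[OF markov Suc.prems]] by auto
  then show ?case using Suc.IH[OF kernel_act_bound[OF _ Suc.prems]] by simp
qed simp

text \<open>The unnormalized variance is \<open>min\<^sub>c \<pi>\<^sub>t ((f - c)\<^sup>2)\<close>, hence non-decreasing in \<open>t\<close>.\<close>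

lemma mass_variance_mono:
  assumes t: "1 \<le> t" and f: "\<And>x. \<bar>f x\<bar> \<le> C"
  shows "total_mass (\<pi> t) * variance (normalized (\<pi> t)) f
    \<le> total_mass (\<pi> (Suc t)) * variance (normalized (\<pi> (Suc t))) f"
proof -
  interpret p: stationary_kernel "K t" "normalized (\<pi> t)" by (rule stationary[OF t])
  interpret p': stationary_kernel "K (Suc t)" "normalized (\<pi> (Suc t))" by (rule stationary) simp
  \<comment> \<open>Centring at the later mean is exact at time \<open>Suc t\<close> and gives an
    upper bound for the variance at time \<open>t\<close>.\<close>
  let ?c = "mean (normalized (\<pi> (Suc t))) f"
  have "(f x - ?c)\<^sup>2 \<le> (C + \<bar>?c\<bar>)\<^sup>2" for x
    using f[of x] by (simp add: abs_le_square_iff[symmetric])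
  then have "total_mass (\<pi> t) * mean (normalized (\<pi> t)) (\<lambda>x. (f x - ?c)\<^sup>2)
    \<le> total_mass (\<pi> (Suc t)) * mean (normalized (\<pi> (Suc t))) (\<lambda>x. (f x - ?c)\<^sup>2)"
    by (intro mass_mean_mono t) auto
  moreover have "total_mass (\<pi> t) * variance (normalized (\<pi> t)) f
      \<le> total_mass (\<pi> t) * mean (normalized (\<pi> t)) (\<lambda>x. (f x - ?c)\<^sup>2)"
    using mass_pos[OF t]
    by (intro mult_left_mono p.variance_le_mean_square(3) p.bounded_imp_l2[OF f]) auto
  moreover have "f \<in> l2_space (normalized (\<pi> (Suc t)))" by (rule p'.bounded_imp_l2[OF f])
  ultimately show ?thesis using p'.variance_le_mean_square(2)[of f ?c] by simp
qed

section \<open>Contraction of the variance along the chain\<close>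

lemma gamma_le_1: "1 \<le> t \<Longrightarrow> gamma_env K \<pi> t \<le> 1"
  unfolding gamma_env_def by (intro stationary_kernel.poincare stationary nontrivial)

lemma alpha_nonneg: "1 \<le> t \<Longrightarrow> 0 \<le> alpha_env K \<pi> t"
  unfolding alpha_env_def by (intro stationary_kernel.log_sobolev stationary nontrivial)

text \<open>The induction peels off the last kernel. The unnormalized variance is first moved up to
  the measure invariant under that kernel, and only there does the Poincare inequality
  apply.\<close>

lemma mass_variance_kernel_chain:
  assumes r: "1 \<le> r" and f: "\<And>x. \<bar>f x\<bar> \<le> C"
  shows "total_mass (\<pi> r) * variance (normalized (\<pi> r)) (kernel_chain K r n f)
    \<le> (\<Prod>l=r+1..r+n. 1 - gamma_env K \<pi> l) *
       (total_mass (\<pi> (r + n)) * variance (normalized (\<pi> (r + n))) f)"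
  using f
proof (induction n arbitrary: f)
  case (Suc n)
  let ?t = "Suc (r + n)" and ?P = "\<Prod>l=r+1..r+n. 1 - gamma_env K \<pi> l"
  let ?g = "kernel_act (K ?t) f"
  have g: "\<bar>?g x\<bar> \<le> C" for x by (rule kernel_act_bound) (use Suc.prems in auto)
  interpret p: stationary_kernel "K ?t" "normalized (\<pi> ?t)" by (rule stationary) simp
  have P0: "0 \<le> ?P" using gamma_le_1 by (intro prod_nonneg) auto
  have "total_mass (\<pi> r) * variance (normalized (\<pi> r)) (kernel_chain K r n ?g)
      \<le> ?P * (total_mass (\<pi> (r + n)) * variance (normalized (\<pi> (r + n))) ?g)"
    by (rule Suc.IH[OF g])
  also have "\<dots> \<le> ?P * (total_mass (\<pi> ?t) * variance (normalized (\<pi> ?t)) ?g)"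
    using r by (intro mult_left_mono P0 mass_variance_mono[OF _ g]) auto
  also have "\<dots> \<le> ?P * (total_mass (\<pi> ?t) * ((1 - gamma_env K \<pi> ?t) * variance (normalized (\<pi> ?t)) f))"
    unfolding gamma_env_def using mass_pos[of ?t]
    by (intro mult_left_mono P0[unfolded gamma_env_def] p.variance_kernel_act_le nontrivial
        p.bounded_imp_l2[OF Suc.prems]) auto
  finally show ?case by (simp add: mult_ac)
qed simp

section \<open>Iterated hypercontractivity up to point evaluation\<close>

text \<open>Signed functions reduce to nonnegative ones through
  \<open>\<bar>K f\<bar> \<le> K \<bar>f\<bar>\<close>.\<close>

lemma hypercontractive_step:
  assumes t: "1 \<le> t" and f: "\<And>x. \<bar>f x\<bar> \<le> C" and q: "2 \<le> q"
    and s: "s = q * (1 + alpha_env K \<pi> t)"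
  shows "mean (normalized (\<pi> t)) (\<lambda>x. \<bar>kernel_act (K t) f x\<bar> powr s) powr (1 / s)
    \<le> mean (normalized (\<pi> t)) (\<lambda>x. \<bar>f x\<bar> powr q) powr (1 / q)"
proof -
  interpret p: stationary_kernel "K t" "normalized (\<pi> t)" by (rule stationary[OF t])
  have s2: "0 < s" using s q alpha_nonneg[OF t] by (simp add: add_pos_nonneg)
  have g: "\<bar>kernel_act (K t) f x\<bar> \<le> C" for x by (rule kernel_act_bound[OF t f])
  have h: "\<bar>kernel_act (K t) (\<lambda>y. \<bar>f y\<bar>) x\<bar> \<le> C" for x by (rule kernel_act_bound[OF t]) (use f in auto)
  have if_int: "p.integrable_p f" "p.integrable_p (\<lambda>y. \<bar>f y\<bar>)" "p.integrable_p (\<lambda>y. - f y)"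
    using p.integrable_p_bounded[of f C] p.integrable_p_bounded[of "\<lambda>y. \<bar>f y\<bar>" C]
      p.integrable_p_bounded[of "\<lambda>y. - f y" C] f by auto
  have neg: "kernel_act (K t) (\<lambda>y. - f y) x = - kernel_act (K t) f x" for x
    by (simp add: kernel_act_def infsum_uminus)
  have le: "\<bar>kernel_act (K t) f x\<bar> \<le> kernel_act (K t) (\<lambda>y. \<bar>f y\<bar>) x" for x
    using p.kernel_act_mono[OF if_int(1,2), of x] p.kernel_act_mono[OF if_int(3,2), of x]
    by (simp add: neg abs_le_iff)
  have "mean (normalized (\<pi> t)) (\<lambda>x. \<bar>kernel_act (K t) f x\<bar> powr s)
      \<le> mean (normalized (\<pi> t)) (\<lambda>x. kernel_act (K t) (\<lambda>y. \<bar>f y\<bar>) x powr s)"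
  proof (rule p.mean_mono)
    show "p.integrable_p (\<lambda>x. \<bar>kernel_act (K t) f x\<bar> powr s)"
      by (rule p.integrable_p_bounded[of _ "C powr s"]) (use g s2 in \<open>auto intro: powr_mono2\<close>)
    show "p.integrable_p (\<lambda>x. kernel_act (K t) (\<lambda>y. \<bar>f y\<bar>) x powr s)"
      by (rule p.integrable_p_bounded[of _ "C powr s"])
         (use h s2 p.kernel_act_nonneg in \<open>auto intro!: powr_mono2 simp: abs_le_iff\<close>)
  qed (use le s2 in \<open>auto intro: powr_mono2\<close>)
  then have "mean (normalized (\<pi> t)) (\<lambda>x. \<bar>kernel_act (K t) f x\<bar> powr s) powr (1 / s)
      \<le> mean (normalized (\<pi> t)) (\<lambda>x. kernel_act (K t) (\<lambda>y. \<bar>f y\<bar>) x powr s) powr (1 / s)"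
    using s2 by (intro powr_mono2 p.mean_nonneg) auto
  also have "\<dots> \<le> mean (normalized (\<pi> t)) (\<lambda>x. \<bar>f x\<bar> powr q) powr (1 / q)"
    by (rule p.hypercontractive[OF nontrivial _ _ q, where C = C]) (use f s in \<open>auto simp: alpha_env_def\<close>)
  finally show ?thesis .
qed

text \<open>Going back from time \<open>n\<close> to time 1 the exponent grows from \<open>q\<close>
  to \<open>s\<close>. The last kernel is peeled off, so the induction needs \<open>f\<close> and
  \<open>q\<close> arbitrary: the shorter chain starts from the raised exponent and ends at the same
  \<open>s\<close>.\<close>

lemma kernel_chain_pointwise:
  assumes "1 \<le> n" and f: "\<And>x. \<bar>f x\<bar> \<le> C" and q: "2 \<le> q"
    and s: "s = q * (\<Prod>u=1..n. 1 + alpha_env K \<pi> u)"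
  shows "\<bar>kernel_chain K 0 n f x\<bar> \<le> (1 / normalized (\<pi> 1) x) powr (1 / s) *
    (total_mass (\<pi> n) / total_mass (\<pi> 1) * mean (normalized (\<pi> n)) (\<lambda>x. \<bar>f x\<bar> powr q)) powr (1 / q)"
  using assms
proof (induction n arbitrary: f q rule: dec_induct)
  case base
  interpret p: stationary_kernel "K 1" "normalized (\<pi> 1)" by (rule stationary) simp
  let ?g = "kernel_act (K 1) f"
  have s2: "0 < s" using base(2,3) alpha_nonneg[of 1] by (simp add: add_pos_nonneg)
  have g: "\<bar>?g x\<bar> \<le> C" for x by (rule kernel_act_bound) (use base in auto)
  have "p.integrable_p (\<lambda>x. \<bar>?g x\<bar> powr s)"
    by (rule p.integrable_p_bounded[of _ "C powr s"]) (use g s2 in \<open>auto intro: powr_mono2\<close>)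
  \<comment> \<open>Point evaluation costs a negative power of the mass, since the value at
    \<open>x\<close> contributes just one term to the mean.\<close>
  from p.le_mean[OF this, of x]
  have "\<bar>?g x\<bar> powr s \<le> mean (normalized (\<pi> 1)) (\<lambda>x. \<bar>?g x\<bar> powr s) * (1 / normalized (\<pi> 1) x)"
    using p.pos[of x] by (simp add: field_simps)
  then have "(\<bar>?g x\<bar> powr s) powr (1 / s)
      \<le> (mean (normalized (\<pi> 1)) (\<lambda>x. \<bar>?g x\<bar> powr s) * (1 / normalized (\<pi> 1) x)) powr (1 / s)"
    using s2 by (intro powr_mono2) auto
  also have "\<dots> = mean (normalized (\<pi> 1)) (\<lambda>x. \<bar>?g x\<bar> powr s) powr (1 / s) * (1 / normalized (\<pi> 1) x) powr (1 / s)"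
    by (intro powr_mult) 
  also have "\<dots> \<le> mean (normalized (\<pi> 1)) (\<lambda>x. \<bar>f x\<bar> powr q) powr (1 / q) * (1 / normalized (\<pi> 1) x) powr (1 / s)"
    by (intro mult_right_mono hypercontractive_step[where C = C]) (use base in auto)
  finally show ?case using s2 mass_pos[of 1] by (simp add: powr_powr mult.commute)
next
  case (step n)
  let ?g = "kernel_act (K (Suc n)) f"
  let ?q = "q * (1 + alpha_env K \<pi> (Suc n))"
  let ?M = "total_mass (\<pi> (Suc n)) / total_mass (\<pi> 1)"
  interpret p: stationary_kernel "K n" "normalized (\<pi> n)" by (rule stationary) (use step in simp)
  interpret p': stationary_kernel "K (Suc n)" "normalized (\<pi> (Suc n))" by (rule stationary) simp
  have q: "q \<le> ?q"
    using mult_left_mono[of 1 "1 + alpha_env K \<pi> (Suc n)" q] alpha_nonneg[of "Suc n"] step.prems(2) by simp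
  have g: "\<bar>?g x\<bar> \<le> C" for x by (rule kernel_act_bound) (use step in auto)
  have M: "1 \<le> ?M" using mass_ge_1[of "Suc n"] mass_pos[of 1] by simp
  have gp: "\<bar>?g x\<bar> powr ?q \<le> C powr ?q" for x using g[of x] q step.prems by (intro powr_mono2) auto
  have "\<bar>kernel_chain K 0 n ?g x\<bar> \<le> (1 / normalized (\<pi> 1) x) powr (1 / s) *
    (total_mass (\<pi> n) / total_mass (\<pi> 1) * mean (normalized (\<pi> n)) (\<lambda>x. \<bar>?g x\<bar> powr ?q)) powr (1 / ?q)"
    using step.IH[OF g, of ?q] q step.prems step.hyps by (simp add: mult_ac)
  also have "\<dots> \<le> (1 / normalized (\<pi> 1) x) powr (1 / s) *
    (?M * mean (normalized (\<pi> (Suc n))) (\<lambda>x. \<bar>f x\<bar> powr q)) powr (1 / q)"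
  proof (rule mult_left_mono)
    have "total_mass (\<pi> n) * mean (normalized (\<pi> n)) (\<lambda>x. \<bar>?g x\<bar> powr ?q)
        \<le> total_mass (\<pi> (Suc n)) * mean (normalized (\<pi> (Suc n))) (\<lambda>x. \<bar>?g x\<bar> powr ?q)"
      by (rule mass_mean_mono[where C = "C powr ?q"]) (use gp step.hyps in auto)
    then have "total_mass (\<pi> n) / total_mass (\<pi> 1) * mean (normalized (\<pi> n)) (\<lambda>x. \<bar>?g x\<bar> powr ?q)
        \<le> ?M * mean (normalized (\<pi> (Suc n))) (\<lambda>x. \<bar>?g x\<bar> powr ?q)"
      using mass_pos[of 1] by (simp add: divide_right_mono)
    then have "(total_mass (\<pi> n) / total_mass (\<pi> 1) * mean (normalized (\<pi> n)) (\<lambda>x. \<bar>?g x\<bar> powr ?q)) powr (1 / ?q)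
        \<le> (?M * mean (normalized (\<pi> (Suc n))) (\<lambda>x. \<bar>?g x\<bar> powr ?q)) powr (1 / ?q)"
      using q step.prems step.hyps mass_pos[of n] mass_pos[of 1] p.mean_nonneg[of "\<lambda>x. \<bar>?g x\<bar> powr ?q"]
      by (intro powr_mono2) auto
    also have "\<dots> = ?M powr (1 / ?q) * mean (normalized (\<pi> (Suc n))) (\<lambda>x. \<bar>?g x\<bar> powr ?q) powr (1 / ?q)"
      by (intro powr_mult)
    \<comment> \<open>As \<open>?M \<ge> 1\<close> and \<open>q \<le> ?q\<close>, the exponent of
      the mass ratio may be raised to \<open>1 / q\<close>. A single ratio thus survives instead of
      a product over all steps.\<close>
    also have "\<dots> \<le> ?M powr (1 / q) * mean (normalized (\<pi> (Suc n))) (\<lambda>x. \<bar>f x\<bar> powr q) powr (1 / q)"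
      using q step.prems M
      by (intro mult_mono powr_mono hypercontractive_step[where C = C]) (auto intro: divide_left_mono)
    also have "\<dots> = (?M * mean (normalized (\<pi> (Suc n))) (\<lambda>x. \<bar>f x\<bar> powr q)) powr (1 / q)"
      by (intro powr_mult[symmetric])
    finally show "(total_mass (\<pi> n) / total_mass (\<pi> 1) * mean (normalized (\<pi> n)) (\<lambda>x. \<bar>?g x\<bar> powr ?q)) powr (1 / ?q)
      \<le> (?M * mean (normalized (\<pi> (Suc n))) (\<lambda>x. \<bar>f x\<bar> powr q)) powr (1 / q)" .
  qed simp
  finally show ?case by simp
qed

section \<open>Laws, duality and total variation\<close>

text \<open>Duality between measures and functions: a new kernel acts last on the law and first on
  \<open>f\<close>. Nonnegativity and summability are carried in the induction because the Fubini
  majorant is built from them.\<close>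

lemma law_kernel_chain:
  "(\<forall>y. 0 \<le> law K x t y) \<and> law K x t summable_on UNIV \<and>
    (\<forall>f C. (\<forall>y. \<bar>f y\<bar> \<le> C) \<longrightarrow> ((\<lambda>y. law K x t y * f y) has_sum kernel_chain K 0 t f x) UNIV)"
proof (induction t)
  case 0
  have "((\<lambda>y. (if y = x then 1 else 0) * f y) has_sum f x) UNIV" for f :: "'a \<Rightarrow> real"
    by (rule has_sum_finite_neutralI[of "{x}"]) auto
  from this this[of "\<lambda>_. 1"] show ?case by (auto dest: has_sum_imp_summable)
next
  case (Suc t)
  let ?\<mu> = "law K x t" and ?K = "K (Suc t)"
  have K: "markov_kernel ?K" by (rule markov) simp
  then have K0: "0 \<le> ?K a b" and K1: "(?K a has_sum 1) UNIV" for a b by (auto simp: markov_kernel_def)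
  have \<mu>0: "0 \<le> ?\<mu> y" and \<mu>s: "?\<mu> summable_on UNIV" for y using Suc by auto
  have nonneg: "0 \<le> law K x (Suc t) y" for y
    by (simp add: measure_act_def infsum_nonneg \<mu>0 K0)
  have chain: "((\<lambda>y. law K x (Suc t) y * f y) has_sum kernel_chain K 0 (Suc t) f x) UNIV"
    if f: "\<And>y. \<bar>f y\<bar> \<le> C" for f C
  proof -
    let ?F = "\<lambda>y z. ?\<mu> z * ?K z y * f y"
    have le: "\<bar>?F y z\<bar> \<le> (?\<mu> z * C) * ?K z y" for y z
      using f[of y] \<mu>0[of z] K0[of z y] by (simp add: abs_mult mult_ac mult_right_mono)
    have w: "((\<lambda>y. (?\<mu> z * C) * ?K z y) has_sum ?\<mu> z * C) UNIV" for z
      using has_sum_cmult_right[OF K1, of "?\<mu> z * C"] by simp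
    have c: "(\<lambda>z. ?\<mu> z * C) summable_on UNIV" by (rule summable_on_cmult_left[OF \<mu>s])
    have 1: "(\<Sum>\<^sub>\<infinity>z. ?F y z) = law K x (Suc t) y * f y" for y
      by (simp add: measure_act_def infsum_cmult_left')
    have 2: "(\<Sum>\<^sub>\<infinity>y. ?F y z) = ?\<mu> z * kernel_act ?K f z" for z
      by (simp add: kernel_act_def mult.assoc infsum_cmult_right')
    have "((\<lambda>z. ?\<mu> z * kernel_act ?K f z) has_sum kernel_chain K 0 t (kernel_act ?K f) x) UNIV"
    proof -
      have "\<forall>z. \<bar>kernel_act ?K f z\<bar> \<le> C" using kernel_act_bound[of "Suc t" f C] f by simp
      then show ?thesis using Suc by blast
    qed
    then have "(\<Sum>\<^sub>\<infinity>z. ?\<mu> z * kernel_act ?K f z) = kernel_chain K 0 (Suc t) f x"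
      by (simp add: infsumI)
    then show ?thesis using fubini_dominated(2)[of ?F, OF le w c] by (simp only: 1 2)
  qed
  have "law K x (Suc t) summable_on UNIV"
    using has_sum_imp_summable[OF chain[of "\<lambda>_. 1" 1]] by simp
  then show ?case using nonneg chain by blast
qed

text \<open>The sign of the difference of the two laws is an optimal test function for total
  variation.\<close>

lemma d_TV_kernel_chain:
  obtains f :: "'a \<Rightarrow> real" where "\<And>z. \<bar>f z\<bar> \<le> 1"
    and "d_TV (law K x t) (law K y t) = (kernel_chain K 0 t f x - kernel_chain K 0 t f y) / 2"
proof
  define f where "f z = sgn (law K x t z - law K y t z)" for z
  show f: "\<bar>f z\<bar> \<le> 1" for z by (simp add: f_def sgn_if)
  have h: "((\<lambda>z. law K a t z * f z) has_sum kernel_chain K 0 t f a) UNIV" for a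
    using law_kernel_chain[of a t] f by blast
  have "((\<lambda>z. law K x t z * f z + - (law K y t z * f z)) has_sum
      (kernel_chain K 0 t f x + - kernel_chain K 0 t f y)) UNIV"
    by (intro has_sum_add has_sum_uminusI h)
  moreover have "law K x t z * f z + - (law K y t z * f z) = \<bar>law K x t z - law K y t z\<bar>" for z
    by (simp add: f_def sgn_if)
  ultimately show "d_TV (law K x t) (law K y t) = (kernel_chain K 0 t f x - kernel_chain K 0 t f y) / 2"
    by (simp add: d_TV_def infsumI)
qed

section \<open>The choice of \<open>r\<close> and the merging bound\<close>

text \<open>The power equals \<open>exp (ln (1 / p z) / q)\<close> with \<open>p\<close> the
  normalized \<open>\<pi> 1\<close>, so it is at most \<open>exp 1\<close> once \<open>q\<close>
  reaches \<open>ln (1 / p z)\<close>. As \<open>q_env\<close> is non-decreasing, the minimal time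
  for \<open>z\<close> may be replaced by any larger \<open>r\<close>.\<close>

lemma r_envD:
  assumes "r_env K \<pi> z \<le> enat r"
  shows "1 \<le> r" and "(1 / normalized (\<pi> 1) z) powr (1 / q_env K \<pi> r) \<le> exp 1"
proof -
  interpret p: stationary_kernel "K 1" "normalized (\<pi> 1)" by (rule stationary) simp
  let ?S = "{s. 1 \<le> s \<and> ln (ln (1 / normalized (\<pi> 1) z)) \<le> ln (q_env K \<pi> s)}"
  have "?S \<noteq> {}"
  proof
    assume "?S = {}"
    then have "r_env K \<pi> z = \<infinity>" unfolding r_env_def by (simp only: image_empty Inf_empty top_enat_def)
    then show False using assms by simp
  qed
  then have "r_env K \<pi> z \<in> enat ` ?S" unfolding r_env_def by (rule Inf_enat_image_in)
  then obtain s where s: "1 \<le> s" "ln (ln (1 / normalized (\<pi> 1) z)) \<le> ln (q_env K \<pi> s)" "s \<le> r"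
    using assms by auto
  then show "1 \<le> r" by simp
  have qpos: "0 < q_env K \<pi> u" for u
    unfolding q_env_def using alpha_nonneg by (auto intro!: prod_pos simp: add_pos_nonneg)
  \<comment> \<open>The outer logarithm can be removed only for a positive argument; a second point
    in the space makes the mass of \<open>z\<close> less than 1.\<close>
  have L: "0 < ln (1 / normalized (\<pi> 1) z)"
    using p.pos[of z] p.p_less_1[OF nontrivial, of z] by (intro ln_gt_zero) auto
  have "ln (1 / normalized (\<pi> 1) z) \<le> q_env K \<pi> s" using s(2) L qpos[of s] by simp
  also have "\<dots> \<le> q_env K \<pi> r"
  proof -
    have "(\<Prod>u=1..s. 1 + alpha_env K \<pi> u) \<le> (\<Prod>u=1..r. 1 + alpha_env K \<pi> u)"
      using s alpha_nonneg by (intro prod_mono2) (auto intro: add_nonneg_nonneg)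
    then show ?thesis by (simp add: q_env_def)
  qed
  finally have "ln (1 / normalized (\<pi> 1) z) / q_env K \<pi> r \<le> 1" using qpos[of r] by simp
  then show "(1 / normalized (\<pi> 1) z) powr (1 / q_env K \<pi> r) \<le> exp 1"
    using p.pos[of z] by (simp add: powr_def)
qed

text \<open>The chain is split at \<open>r\<close>: the last \<open>t - r\<close> kernels bring
  \<open>f\<close> close to a constant in mean square, and the first \<open>r\<close> turn this into
  pointwise closeness.\<close>

lemma d_TV_le:
  assumes r: "r_env K \<pi> x \<le> enat r" "r_env K \<pi> y \<le> enat r" and t: "r \<le> t"
  shows "d_TV (law K x t) (law K y t)
    \<le> exp 1 * sqrt (total_mass (\<pi> t) / total_mass (\<pi> 1)) * (\<Prod>l=r+1..t. sqrt (1 - gamma_env K \<pi> l))"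
proof -
  obtain f :: "'a \<Rightarrow> real" where f: "\<And>z. \<bar>f z\<bar> \<le> 1"
    and d: "d_TV (law K x t) (law K y t) = (kernel_chain K 0 t f x - kernel_chain K 0 t f y) / 2"
    using d_TV_kernel_chain[of x t y] by blast
  have r1: "1 \<le> r" by (rule r_envD(1)[OF r(1)])
  interpret p: stationary_kernel "K r" "normalized (\<pi> r)" by (rule stationary[OF r1])
  interpret p': stationary_kernel "K t" "normalized (\<pi> t)" by (rule stationary) (use r1 t in simp)
  define g where "g = kernel_chain K r (t - r) f"
  define c where "c = mean (normalized (\<pi> r)) g"
  define P where "P = (\<Prod>l=r+1..t. 1 - gamma_env K \<pi> l)"
  have g: "\<bar>g z\<bar> \<le> 1" for z unfolding g_def by (rule kernel_chain_bound[OF f])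
  have gc: "\<bar>g z - c\<bar> \<le> 1 + \<bar>c\<bar>" for z using g[of z] by linarith
  have P0: "0 \<le> P" unfolding P_def using gamma_le_1 by (intro prod_nonneg) auto
  have v1: "variance (normalized (\<pi> t)) f \<le> 1"
  proof -
    have "variance (normalized (\<pi> t)) f \<le> mean (normalized (\<pi> t)) (\<lambda>x. (f x - 0)\<^sup>2)"
      by (rule p'.variance_le_mean_square(3)[OF p'.bounded_imp_l2[OF f]])
    also have "\<dots> \<le> mean (normalized (\<pi> t)) (\<lambda>_. 1)"
      by (intro p'.mean_mono p'.variance_le_mean_square(1)[OF p'.bounded_imp_l2[OF f]] p'.integrable_p_const)
         (use f in \<open>simp add: abs_square_le_1\<close>)
    finally show ?thesis by (simp add: p'.mean_const)
  qed
  have "total_mass (\<pi> r) * mean (normalized (\<pi> r)) (\<lambda>x. (g x - c)\<^sup>2)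
      = total_mass (\<pi> r) * variance (normalized (\<pi> r)) g"
    using p.variance_le_mean_square(2)[of g c] p.bounded_imp_l2[of g 1] g by (simp add: c_def)
  also have "\<dots> \<le> P * (total_mass (\<pi> t) * variance (normalized (\<pi> t)) f)"
    using mass_variance_kernel_chain[OF r1 f, of "t - r"] t by (simp add: g_def P_def)
  also have "\<dots> \<le> P * (total_mass (\<pi> t) * 1)"
    using mass_pos[of t] r1 t by (intro mult_left_mono P0 v1) auto
  finally have V: "total_mass (\<pi> r) * mean (normalized (\<pi> r)) (\<lambda>x. (g x - c)\<^sup>2) \<le> P * total_mass (\<pi> t)"
    by simp
  have bound: "\<bar>kernel_chain K 0 t f z - c\<bar> \<le> exp 1 * sqrt (P * total_mass (\<pi> t) / total_mass (\<pi> 1))"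
    if z: "r_env K \<pi> z \<le> enat r" for z
  proof -
    have "kernel_chain K 0 t f z - c = kernel_chain K 0 r (\<lambda>x. g x - c) z"
      using kernel_chain_add[of K 0 r "t - r" f] t kernel_chain_diff_const[of g 1, OF g] by (simp add: g_def)
    also have "\<bar>\<dots>\<bar> \<le> (1 / normalized (\<pi> 1) z) powr (1 / q_env K \<pi> r) *
      (total_mass (\<pi> r) / total_mass (\<pi> 1) * mean (normalized (\<pi> r)) (\<lambda>x. \<bar>g x - c\<bar> powr 2)) powr (1 / 2)"
      \<comment> \<open>The starting exponent 2 matches the variance, and it is the factor 2 in
        \<open>q_env\<close>.\<close>
      by (rule kernel_chain_pointwise[OF r1 gc]) (simp_all add: q_env_def)
    also have "\<dots> \<le> exp 1 * sqrt (P * total_mass (\<pi> t) / total_mass (\<pi> 1))"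
    proof (rule mult_mono)
      \<comment> \<open>The mass at time \<open>r\<close> is absorbed into the unnormalized
        variance, so only the masses at times 1 and \<open>t\<close> remain in the bound.\<close>
      have "(total_mass (\<pi> r) / total_mass (\<pi> 1) * mean (normalized (\<pi> r)) (\<lambda>x. \<bar>g x - c\<bar> powr 2)) powr (1 / 2)
        = sqrt (total_mass (\<pi> r) * mean (normalized (\<pi> r)) (\<lambda>x. (g x - c)\<^sup>2) / total_mass (\<pi> 1))"
        using mass_pos[OF r1] mass_pos[of 1] p.mean_nonneg[of "\<lambda>x. (g x - c)\<^sup>2"]
        by (simp add: powr_half_sqrt)
      also have "\<dots> \<le> sqrt (P * total_mass (\<pi> t) / total_mass (\<pi> 1))"
        using V mass_pos[of 1] by (simp add: divide_right_mono)
      finally show "(total_mass (\<pi> r) / total_mass (\<pi> 1) *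
        mean (normalized (\<pi> r)) (\<lambda>x. \<bar>g x - c\<bar> powr 2)) powr (1 / 2) \<le> \<dots>" .
    qed (use r_envD(2)[OF z] in auto)
    finally show ?thesis .
  qed
  have "d_TV (law K x t) (law K y t) \<le> exp 1 * sqrt (P * total_mass (\<pi> t) / total_mass (\<pi> 1))"
  proof -
    \<comment> \<open>Both values lie within \<open>B\<close> of the same constant \<open>c\<close>;
      the factor one half in \<open>d_TV\<close> absorbs the two uses of the bound.\<close>
    have "(a - b) / 2 \<le> B" if "\<bar>a - c\<bar> \<le> B" "\<bar>b - c\<bar> \<le> B" for a b B :: real
      using that by (simp add: abs_le_iff)
    from this[OF bound[OF r(1)] bound[OF r(2)]] show ?thesis unfolding d .
  qed
  also have "\<dots> = exp 1 * sqrt (total_mass (\<pi> t) / total_mass (\<pi> 1)) * sqrt P"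
    by (simp add: real_sqrt_mult[symmetric])
  also have "sqrt P = (\<Prod>l=r+1..t. sqrt (1 - gamma_env K \<pi> l))"
    unfolding P_def by (rule sqrt_prod)
  finally show ?thesis .
qed

end

theorem theorem1p21:
  fixes K :: "nat \<Rightarrow> 'a::countable \<Rightarrow> 'a \<Rightarrow> real"
    and \<pi> :: "nat \<Rightarrow> 'a \<Rightarrow> real"
    and x y :: 'a and r :: nat
  assumes "\<exists>a b :: 'a. a \<noteq> b"
    and "\<And>t. t \<ge> 1 \<Longrightarrow> markov_kernel (K t)"
    and "\<And>t. t \<ge> 1 \<Longrightarrow> irreducible_kernel (K t)"
    and "\<And>t. t \<ge> 1 \<Longrightarrow> aperiodic_kernel (K t)"
    and "finite_nondecreasing_env K \<pi>"
    and "max (r_env K \<pi> x) (r_env K \<pi> y) = enat r"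
  shows "(\<forall>t\<ge>r. d_TV (law K x t) (law K y t)
             \<le> exp 1 * sqrt (total_mass (\<pi> t) / total_mass (\<pi> 1))
                 * (\<Prod>l=r+1..t. sqrt (1 - gamma_env K \<pi> l)))
       \<and> (\<forall>\<eta>. 0 < \<eta> \<and> \<eta> < 1 \<longrightarrow>
           T_mer K x y \<eta> \<le> enat r + Inf (enat ` {u. u \<ge> 1 \<and>
              exp 1 * sqrt (total_mass (\<pi> (r + u)) / total_mass (\<pi> 1))
                * (\<Prod>l=r+1..r+u. sqrt (1 - gamma_env K \<pi> l)) \<le> \<eta>}))"
proof -
  interpret merging_env K \<pi> by unfold_locales (use assms in auto)
  have r: "r_env K \<pi> x \<le> enat r" "r_env K \<pi> y \<le> enat r"
    using assms(6) by (metis max.cobounded1, metis max.cobounded2)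
  let ?b = "\<lambda>t. exp 1 * sqrt (total_mass (\<pi> t) / total_mass (\<pi> 1))
    * (\<Prod>l=r+1..t. sqrt (1 - gamma_env K \<pi> l))"
  have tv: "d_TV (law K x t) (law K y t) \<le> ?b t" if "r \<le> t" for t
    by (rule d_TV_le[OF r that])
  have "T_mer K x y \<eta> \<le> enat r + Inf (enat ` {u. u \<ge> 1 \<and> ?b (r + u) \<le> \<eta>})" for \<eta>
  \<comment> \<open>If no such \<open>u\<close> exists the right-hand side is \<infinity>. Otherwise
    the infimum is attained at some \<open>u\<close>, and \<open>r + u\<close> is an admissible
    merging time.\<close>
  proof (cases "{u. u \<ge> 1 \<and> ?b (r + u) \<le> \<eta>} = {}")
    case True
    then show ?thesis by (simp only: image_empty Inf_empty) (simp add: top_enat_def)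
  next
    case False
    then have "Inf (enat ` {u. u \<ge> 1 \<and> ?b (r + u) \<le> \<eta>}) \<in> enat ` {u. u \<ge> 1 \<and> ?b (r + u) \<le> \<eta>}"
      by (rule Inf_enat_image_in)
    then obtain u where u: "1 \<le> u" "?b (r + u) \<le> \<eta>"
      and eq: "Inf (enat ` {u. u \<ge> 1 \<and> ?b (r + u) \<le> \<eta>}) = enat u" by blast
    have "T_mer K x y \<eta> \<le> enat (r + u)"
      unfolding T_mer_def using u tv[of "r + u"] by (intro Inf_lower imageI) auto
    then show ?thesis unfolding eq by simp
  qed
  then show ?thesis using tv by blast
qed

end
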